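(* Let $X$ be a Hilbert $C^*$-module over a $C^*$-algebra $B$, let $M,N\subset X$ be complemented submodules, and let $P_M,P_N\in\mathrm{End}^*_B(X)$ be the orthogonal projections onto $M$ and $N$. Then the following are equivalent: 1. $c(M,N)<1$; 2. the sequence $(P_MP_N)^n$ is Cauchy for the operator norm; 3. $M\cap N$ is complemented and $\|P_MP_N-P_{M\cap N}\|=\|P_NP_M-P_{M\cap N}\|<1$; 4. $M\cap N$ is complemented and the operators $1-P_MP_N:(M\cap N)^\perp\to(M\cap N)^\perp$ and $1-P_NP_M:(M\cap N)^\perp\to(M\cap N)^\perp$ are bijective; 5. $\mathrm{Ran}(1-P_MP_N)$ and $\mathrm{Ran}(1-P_NP_M)$ are closed; 6. $X=(M\cap N)\oplus(M^\perp+N^\perp)$; 7. $M^\perp+N^\perp$ is closed; 8. $X=(M^\perp\cap N^\perp)\oplus(M+N)$; 9. $M+N$ is closed; 10. $M\cap N$ is complemented and $\big((M\cap N)^\perp\cap M\big)+\big((M\cap N)^\perp\cap N\big)$ is closed.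
   Context: $\mathrm{End}^*_B(X)$ is the unital $C^*$-algebra of adjointable operators on $X$. A closed submodule $\Omega\subset X$ is complemented if $X=\Omega\oplus\Omega^\perp$, where $\Omega^\perp=\{x\in X:\langle x,y\rangle=0\ \forall y\in\Omega\}$; then $P_\Omega\in\mathrm{End}^*_B(X)$ denotes the orthogonal projection onto $\Omega$. The (cosine of the) Friedrichs angle $c(M,N)$ of an arbitrary pair of complemented submodules is defined by localisation: for a representation $\pi:B\to\mathbb{B}(H_\pi)$ on a Hilbert space, let $X_\pi:=X\otimes_B H_\pi$ be the Hilbert space given by the interior tensor product, and for a closed submodule $\Omega\subset X$ let $\Omega_\pi:=\Omega\otimes_BH_\pi$, regarded as a closed subspace of $X_\pi$. Put $c_\pi(M,N):=\|P_{M_\pi}P_{N_\pi}-P_{M_\pi\cap N_\pi}\|$, with $P_V$ the orthogonal projection in $\mathbb{B}(X_\pi)$ onto the closed subspace $V$. This quantity is the same for all faithful representations $\pi$ of $B$, and $c(M,N):=c_\pi(M,N)$ for any faithful $\pi$. *)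

theory Defs
  imports "HOL-Analysis.Analysis" "HOL-Library.Set_Algebras"
begin

section \<open>Complex normed spaces, Hilbert spaces and C*-algebras\<close>

class complex_normed_vector = real_normed_vector +
  fixes scaleC :: "complex \<Rightarrow> 'a \<Rightarrow> 'a"  (infixr \<open>*\<^sub>C\<close> 75)
  assumes scaleC_add_right: "a *\<^sub>C (x + y) = a *\<^sub>C x + a *\<^sub>C y"
    and scaleC_add_left: "(a + b) *\<^sub>C x = a *\<^sub>C x + b *\<^sub>C x"
    and scaleC_scaleC: "a *\<^sub>C b *\<^sub>C x = (a * b) *\<^sub>C x"
    and scaleC_of_real: "complex_of_real r *\<^sub>C x = r *\<^sub>R x"
    and norm_scaleC: "norm (a *\<^sub>C x) = cmod a * norm x"

class complex_banach = complex_normed_vector + complete_space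

text \<open>All inner products, scalar- and algebra-valued, are linear in the second variable.\<close>

class complex_hilbert_space = complex_banach +
  fixes cinner :: "'a \<Rightarrow> 'a \<Rightarrow> complex"
  assumes cinner_add_right: "cinner x (y + z) = cinner x y + cinner x z"
    and cinner_scaleC_right: "cinner x (a *\<^sub>C y) = a * cinner x y"
    and cinner_commute: "cinner y x = cnj (cinner x y)"
    and cinner_self: "cinner x x = complex_of_real ((norm x)\<^sup>2)"

text \<open>C*-algebras are not assumed to have a unit, and the zero algebra is allowed.\<close>

class cstar_algebra = complex_banach + real_normed_algebra +
  fixes star :: "'a \<Rightarrow> 'a"  (\<open>(_\<^sup>\<star>)\<close> [1000] 999)
  assumes mult_scaleC_left: "(c *\<^sub>C a) * b = c *\<^sub>C (a * b)"
    and mult_scaleC_right: "a * (c *\<^sub>C b) = c *\<^sub>C (a * b)"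
    and star_add: "(a + b)\<^sup>\<star> = a\<^sup>\<star> + b\<^sup>\<star>"
    and star_scaleC: "(c *\<^sub>C a)\<^sup>\<star> = cnj c *\<^sub>C a\<^sup>\<star>"
    and star_mult: "(a * b)\<^sup>\<star> = b\<^sup>\<star> * a\<^sup>\<star>"
    and star_star: "(a\<^sup>\<star>)\<^sup>\<star> = a"
    and cstar_identity: "norm (a\<^sup>\<star> * a) = (norm a)\<^sup>2"

definition cstar_positive :: "'b::cstar_algebra \<Rightarrow> bool"
  where "cstar_positive b \<longleftrightarrow> (\<exists>a. b = a\<^sup>\<star> * a)"

instantiation complex :: complex_hilbert_space
begin
definition scaleC_complex :: "complex \<Rightarrow> complex \<Rightarrow> complex"
  where "scaleC_complex = (*)"
definition cinner_complex :: "complex \<Rightarrow> complex \<Rightarrow> complex"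
  where "cinner_complex x y = cnj x * y"
instance
proof
  fix a b x y z :: complex and r :: real
  show "a *\<^sub>C (x + y) = a *\<^sub>C x + a *\<^sub>C y" "(a + b) *\<^sub>C x = a *\<^sub>C x + b *\<^sub>C x"
    "a *\<^sub>C b *\<^sub>C x = (a * b) *\<^sub>C x" "complex_of_real r *\<^sub>C x = r *\<^sub>R x"
    "norm (a *\<^sub>C x) = cmod a * norm x"
    by (simp_all add: scaleC_complex_def distrib_left distrib_right mult.assoc scaleR_conv_of_real norm_mult)
  show "cinner x (y + z) = cinner x y + cinner x z" "cinner x (a *\<^sub>C y) = a * cinner x y"
    "cinner y x = cnj (cinner x y)"
    by (simp_all add: scaleC_complex_def cinner_complex_def distrib_left mult_ac)
  show "cinner x x = complex_of_real ((norm x)\<^sup>2)"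
    unfolding cinner_complex_def complex_norm_square by (rule mult.commute)
qed
end

instantiation complex :: cstar_algebra
begin
definition star_complex :: "complex \<Rightarrow> complex"
  where "star_complex = cnj"
instance
  by standard (auto simp: scaleC_complex_def star_complex_def norm_mult power2_eq_square)
end

section \<open>Hilbert C*-modules\<close>

text \<open>The norm of the module is the given one of the type, so completeness is the
  sort constraint and the last axiom identifies it with the norm of the inner product
  (which makes the inner product definite).\<close>

locale hilbert_module =
  fixes act :: "'x::complex_banach \<Rightarrow> 'b::cstar_algebra \<Rightarrow> 'x"
    and ip :: "'x \<Rightarrow> 'x \<Rightarrow> 'b"
  assumes act_add_left: "act (x + y) b = act x b + act y b"
    and act_add_right: "act x (a + b) = act x a + act x b"
    and act_mult: "act x (a * b) = act (act x a) b"
    and act_scaleC_left: "act (c *\<^sub>C x) b = c *\<^sub>C act x b"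
    and act_scaleC_right: "act x (c *\<^sub>C b) = c *\<^sub>C act x b"
    and ip_add_right: "ip x (y + z) = ip x y + ip x z"
    and ip_scaleC_right: "ip x (c *\<^sub>C y) = c *\<^sub>C ip x y"
    and ip_act_right: "ip x (act y b) = ip x y * b"
    and ip_star: "ip y x = (ip x y)\<^sup>\<star>"
    and ip_positive: "cstar_positive (ip x x)"
    and norm_ip: "norm x = sqrt (norm (ip x x))"

definition submodule :: "('x::complex_banach \<Rightarrow> 'b::cstar_algebra \<Rightarrow> 'x) \<Rightarrow> 'x set \<Rightarrow> bool"
  where "submodule act S \<longleftrightarrow> 0 \<in> S \<and> (\<forall>x\<in>S. \<forall>y\<in>S. x + y \<in> S) \<and>
    (\<forall>c. \<forall>x\<in>S. c *\<^sub>C x \<in> S) \<and> (\<forall>b. \<forall>x\<in>S. act x b \<in> S)"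

definition orth :: "('x \<Rightarrow> 'x \<Rightarrow> 'b::zero) \<Rightarrow> 'x set \<Rightarrow> 'x set"
  where "orth ip S = {x. \<forall>y\<in>S. ip x y = 0}"

text \<open>The whole space is the direct sum of the subspaces \<open>U\<close> and \<open>V\<close>;
  the sum of sets is the elementwise one.\<close>

definition direct_sum :: "'x::ab_group_add set \<Rightarrow> 'x set \<Rightarrow> bool"
  where "direct_sum U V \<longleftrightarrow> U + V = UNIV \<and> U \<inter> V = {0}"

definition complemented ::
    "('x::complex_banach \<Rightarrow> 'b::cstar_algebra \<Rightarrow> 'x) \<Rightarrow> ('x \<Rightarrow> 'x \<Rightarrow> 'b) \<Rightarrow> 'x set \<Rightarrow> bool"
  where "complemented act ip S \<longleftrightarrow> submodule act S \<and> closed S \<and> direct_sum S (orth ip S)"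

text \<open>The orthogonal projection onto \<open>S\<close>. It is used both in Hilbert modules, for complemented
  submodules, and (with \<open>ip = cinner\<close>) in Hilbert spaces, for closed subspaces.\<close>

definition proj :: "('x::ab_group_add \<Rightarrow> 'x \<Rightarrow> 'b::zero) \<Rightarrow> 'x set \<Rightarrow> 'x \<Rightarrow> 'x"
  where "proj ip S x = (THE y. y \<in> S \<and> x - y \<in> orth ip S)"

definition onorm_Cauchy :: "(nat \<Rightarrow> 'x::real_normed_vector \<Rightarrow> 'x) \<Rightarrow> bool"
  where "onorm_Cauchy T \<longleftrightarrow>
    (\<forall>e>0. \<exists>k. \<forall>m\<ge>k. \<forall>n\<ge>k. onorm (\<lambda>x. T m x - T n x) < e)"

section \<open>Localisation and the Friedrichs angle\<close>

text \<open>Representations are *-homomorphisms into the bounded operators; they may be degenerate.\<close>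

definition representation :: "('b::cstar_algebra \<Rightarrow> 'h::complex_hilbert_space \<Rightarrow> 'h) \<Rightarrow> bool"
  where "representation \<pi> \<longleftrightarrow>
    (\<forall>b. bounded_linear (\<pi> b)) \<and> (\<forall>b c h. \<pi> b (c *\<^sub>C h) = c *\<^sub>C \<pi> b h) \<and>
    (\<forall>a b h. \<pi> (a + b) h = \<pi> a h + \<pi> b h) \<and> (\<forall>c b h. \<pi> (c *\<^sub>C b) h = c *\<^sub>C \<pi> b h) \<and>
    (\<forall>a b h. \<pi> (a * b) h = \<pi> a (\<pi> b h)) \<and>
    (\<forall>b h k. cinner (\<pi> (b\<^sup>\<star>) h) k = cinner h (\<pi> b k))"

definition faithful_representation ::
    "('b::cstar_algebra \<Rightarrow> 'h::complex_hilbert_space \<Rightarrow> 'h) \<Rightarrow> bool"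
  where "faithful_representation \<pi> \<longleftrightarrow> representation \<pi> \<and> inj \<pi>"

text \<open>The Hilbert space \<open>'k\<close>, with \<open>\<tau> x h\<close> in the role of the elementary tensor of \<open>x\<close> and \<open>h\<close>,
  is the interior tensor product \<open>X \<otimes>\<^sub>B H\<close>: the Hausdorff completion of the
  algebraic \<open>B\<close>-balanced tensor product for the semi-inner product determined on elementary tensors
  by \<open>\<pi>\<close> and \<open>ip\<close>. A completion is determined up to a unique unitary compatible with \<open>\<tau>\<close>, so it
  is given by its structure map: a balanced bilinear map with the prescribed inner products
  and total range. The real span below is already a complex subspace, since \<open>\<tau> x (c *\<^sub>C h) = c *\<^sub>C \<tau> x h\<close>.\<close>

definition interior_tensor_product ::
    "('x::complex_banach \<Rightarrow> 'b::cstar_algebra \<Rightarrow> 'x) \<Rightarrow> ('x \<Rightarrow> 'x \<Rightarrow> 'b) \<Rightarrow>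
     ('b \<Rightarrow> 'h::complex_hilbert_space \<Rightarrow> 'h) \<Rightarrow> ('x \<Rightarrow> 'h \<Rightarrow> 'k::complex_hilbert_space) \<Rightarrow> bool"
  where "interior_tensor_product act ip \<pi> \<tau> \<longleftrightarrow>
    (\<forall>x y h. \<tau> (x + y) h = \<tau> x h + \<tau> y h) \<and> (\<forall>c x h. \<tau> (c *\<^sub>C x) h = c *\<^sub>C \<tau> x h) \<and>
    (\<forall>x h k. \<tau> x (h + k) = \<tau> x h + \<tau> x k) \<and> (\<forall>c x h. \<tau> x (c *\<^sub>C h) = c *\<^sub>C \<tau> x h) \<and>
    (\<forall>x b h. \<tau> (act x b) h = \<tau> x (\<pi> b h)) \<and>
    (\<forall>x y h k. cinner (\<tau> x h) (\<tau> y k) = cinner h (\<pi> (ip x y) k)) \<and>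
    closure (span {\<tau> x h |x h. True}) = UNIV"

text \<open>The localisation \<open>\<Omega> \<otimes>\<^sub>B H\<close> of a submodule, as a closed subspace of \<open>X \<otimes>\<^sub>B H\<close>.\<close>

definition localise ::
    "('x \<Rightarrow> 'h::complex_hilbert_space \<Rightarrow> 'k::complex_hilbert_space) \<Rightarrow> 'x set \<Rightarrow> 'k set"
  where "localise \<tau> \<Omega> = closure (span {\<tau> x h |x h. x \<in> \<Omega>})"

definition friedrichs_angle ::
    "('x \<Rightarrow> 'h::complex_hilbert_space \<Rightarrow> 'k::complex_hilbert_space) \<Rightarrow> 'x set \<Rightarrow> 'x set \<Rightarrow> real"
  where "friedrichs_angle \<tau> M N =
    onorm (\<lambda>z. proj cinner (localise \<tau> M) (proj cinner (localise \<tau> N) z)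
             - proj cinner (localise \<tau> M \<inter> localise \<tau> N) z)"

definition tfae :: "bool list \<Rightarrow> bool"
  where "tfae ps \<longleftrightarrow> (\<forall>p\<in>set ps. \<forall>q\<in>set ps. p \<longleftrightarrow> q)"

end

theory Submission
  imports Defs
begin

text \<open>
  Everything takes place among the adjointable operators on \<open>X\<close>, and no spectral theory of
  C*-algebras is used: where positivity of \<open>a\<^sup>* a + b\<^sup>* b\<close> would be invoked, one compares
  the vectors \<open>S x + i T x\<close> and \<open>S x - i T x\<close>, which have the same norm when \<open>S\<close> and \<open>T\<close> are
  self-adjoint and commute. Together with square roots of \<open>1 - C\<close> for self-adjoint
  contractions \<open>C\<close> this yields the estimates on products of projections.

  The pivot is condition (6), \<open>X = (M \<inter> N) \<oplus> (M\<^sup>\<bottom> + N\<^sup>\<bottom>)\<close>. It is obtained from closedness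
  of \<open>M\<^sup>\<bottom> + N\<^sup>\<bottom>\<close>, or of the range of \<open>1 - P Q\<close>, by the closed range theorem for adjointable
  operators, applied to \<open>P (1 - Q)\<close> and \<open>1 - P Q\<close>. Conversely (6) makes \<open>1 - P' Q' P'\<close> invertible,
  where \<open>P'\<close> and \<open>Q'\<close> project onto the parts of \<open>M\<close> and \<open>N\<close> orthogonal to \<open>M \<inter> N\<close>,
  and this forces \<open>\<parallel>P' Q'\<parallel> < 1\<close>. For the angle, norm bounds pass from \<open>X\<close> to the localisation through
  \<open>1 - T\<^sup>* T = W\<^sup>2\<close>, while in the other direction injectivity of the representation shows
  that a self-adjoint polynomial in \<open>P\<close> and \<open>Q\<close> that is positive on the localisation has a square
  root on \<open>X\<close>.
\<close>

section \<open>Operators on Banach spaces\<close>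

text \<open>The Cauchy-Schwarz inequality with constant 1 rests on the order of the algebra;
  polarisation and the triangle inequality of the given norm yield only the constant 4. That is
  harmless for closed ranges and for convergence. Where sharpness matters, as for a norm strictly
  below 1, the bound comes from an identity S^2 + T^2 = c with commuting self-adjoint S and T. The
  obstacle in comparing \<open>X\<close> with its localisation is the intersection. The angle
  involves the intersection of the two localised subspaces, which is not known beforehand to be the
  localisation of \<open>M \<inter> N\<close>, and \<open>M \<inter> N\<close> itself need not be
  complemented. Both directions therefore use data that mention no intersection: the powers of P Q
  are transported to the localisation, and the inequality D^2 \<ge> \<delta> D for D = 1 - Q P Q is
  transported back.\<close>

instance complex_banach \<subseteq> banach ..

text \<open>By Baire's theorem in the closed range, the closure of the image of some ball has
  relative interior there. This yields preimages up to an error of half the norm, and correcting the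
  error repeatedly gives an exact preimage.\<close>

lemma open_mapping_closed_range:
  fixes T :: "'a::banach \<Rightarrow> 'b::banach"
  assumes T: "bounded_linear T" and cl: "closed (range T)"
  obtains C where "C > 0" "\<And>y. y \<in> range T \<Longrightarrow> \<exists>x. T x = y \<and> norm x \<le> C * norm y"
proof -
  interpret T: bounded_linear T by (rule T)
  define V where "V = range T"
  have subV: "subspace V"
    unfolding V_def by (simp add: T.linear linear_subspace_image)
  define K where "K n = closure (T ` cball 0 (real n))" for n :: nat
  have KV: "K n \<subseteq> V" for n
    unfolding K_def V_def by (rule closure_minimal) (auto simp: cl)
  have clK: "closedin (top_of_set V) (K n)" for n
    using KV[of n] unfolding K_def by (metis closed_closure closed_subset)
  have "completely_metrizable_space (top_of_set V)"
    using cl unfolding V_def closed_closedin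
    by (rule completely_metrizable_space_closedin[OF completely_metrizable_space_euclidean])
  moreover have "\<Union>(range K) = V"
  proof (rule antisym[rotated])
    show "V \<subseteq> \<Union>(range K)"
    proof
      fix y assume "y \<in> V"
      then obtain x where "y = T x" by (auto simp: V_def)
      moreover obtain n where "norm x \<le> real n" using real_arch_simple by blast
      ultimately have "y \<in> T ` cball 0 (real n)" by auto
      then show "y \<in> \<Union>(range K)" unfolding K_def by (meson UN_iff UNIV_I closure_subset subsetD)
    qed
    show "\<Union>(range K) \<subseteq> V" using KV by (simp add: UN_subset_iff)
  qed
  moreover have "V \<noteq> {}" by (simp add: V_def)
  moreover have "top_of_set V interior_of V = V"
    by (metis interior_of_topspace topspace_euclidean_subtopology)
  ultimately have "\<not> (\<forall>n. top_of_set V interior_of (K n) = {})"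
  proof (intro notI)
    assume cm: "completely_metrizable_space (top_of_set V)" and KV': "\<Union>(range K) = V" "V \<noteq> {}"
      "top_of_set V interior_of V = V" and E: "\<forall>n. top_of_set V interior_of (K n) = {}"
    have "top_of_set V interior_of \<Union>(range K) = {}"
      by (rule Baire_category_alt) (use cm clK E in auto)
    with KV' show False by simp
  qed
  then obtain n where "top_of_set V interior_of (K n) \<noteq> {}" by blast
  then obtain y0 where "y0 \<in> top_of_set V interior_of (K n)" by blast
  then obtain U where U: "open U" "y0 \<in> U" "y0 \<in> V" "U \<inter> V \<subseteq> K n"
    unfolding interior_of_def openin_open by blast
  then obtain r where r: "r > 0" "ball y0 r \<subseteq> U" using open_contains_ball by blast
  have approx: "\<exists>x. norm x \<le> (4 * n / r) * norm y \<and> norm (y - T x) \<le> norm y / 2" if y: "y \<in> V" for y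
  proof (cases "y = 0")
    case True
    then show ?thesis by (intro exI[of _ 0]) (simp add: T.zero)
  next
    case False
    \<comment> \<open>The scaling keeps \<open>y0 + s *\<^sub>R y\<close> in the ball about
      \<open>y0\<close>. Subtracting approximate preimages of this vector and of \<open>y0\<close>
      removes \<open>y0\<close>, and the two errors \<open>r / 8\<close> become
      \<open>norm y / 2\<close> after division by \<open>s\<close>.\<close>
    define s where "s = r / (2 * norm y)"
    have s: "s > 0" using r False by (simp add: s_def)
    have ns: "norm (s *\<^sub>R y) = r / 2" using False r by (simp add: s_def)
    have "y0 + s *\<^sub>R y \<in> U \<inter> V"
      using r(2) ns r(1) U(3) y subV by (auto simp: dist_norm subspace_add subspace_scale)
    then have "y0 + s *\<^sub>R y \<in> K n" "y0 \<in> K n" using U by blast+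
    moreover have "\<exists>a. norm a \<le> n \<and> norm (T a - z) < r / 8" if "z \<in> K n" for z
    proof -
      have "r / 8 > 0" using r by simp
      then have "\<exists>v\<in>T ` cball 0 (real n). dist v z < r / 8"
        using that unfolding K_def closure_approachable by blast
      then show ?thesis by (auto simp: dist_norm)
    qed
    ultimately obtain a b where ab: "norm a \<le> n" "norm b \<le> n"
       "norm (T a - (y0 + s *\<^sub>R y)) < r / 8" "norm (T b - y0) < r / 8"
      by blast
    define x where "x = (1 / s) *\<^sub>R (a - b)"
    have "norm (s *\<^sub>R y - T (a - b)) \<le> norm (T a - (y0 + s *\<^sub>R y)) + norm (T b - y0)"
      using norm_triangle_ineq4[of "T b - y0" "T a - (y0 + s *\<^sub>R y)"] by (simp add: T.diff algebra_simps)
    then have "norm (s *\<^sub>R y - T (a - b)) \<le> r / 4" using ab by linarith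
    moreover have "T (a - b) = s *\<^sub>R T x"
      using s unfolding x_def T.scaleR by simp
    then have "s *\<^sub>R y - T (a - b) = s *\<^sub>R (y - T x)"
      by (simp add: scaleR_right_diff_distrib)
    ultimately have "s * norm (y - T x) \<le> r / 4" using s by simp
    then have 1: "norm (y - T x) \<le> norm y / 2"
      using s False r unfolding s_def by (simp add: field_simps)
    have "norm (a - b) \<le> 2 * n" using ab norm_triangle_ineq4[of a b] by linarith
    then have "norm x \<le> (1 / s) * (2 * n)" using s unfolding x_def by (simp add: divide_right_mono)
    also have "\<dots> = (4 * n / r) * norm y" using r False by (simp add: s_def)
    finally show ?thesis using 1 by blast
  qed
  then obtain g where g: "\<And>y. y \<in> V \<Longrightarrow> norm (g y) \<le> (4 * n / r) * norm y"
      "\<And>y. y \<in> V \<Longrightarrow> norm (y - T (g y)) \<le> norm y / 2" by metis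
  show thesis
  proof
    \<comment> \<open>The geometric series doubles the bound \<open>4 * n / r\<close>; the summand 1
      keeps the constant positive for \<open>n = 0\<close>.\<close>
    show "8 * n / r + 1 > 0" using r by (simp add: add_nonneg_pos)
    fix y assume "y \<in> range T"
    then have y: "y \<in> V" by (simp add: V_def)
    define e where "e k = ((\<lambda>z. z - T (g z)) ^^ k) y" for k
    have e_Suc: "e (Suc k) = e k - T (g (e k))" for k by (simp add: e_def)
    have eV: "e k \<in> V" for k
    proof (induction k)
      case (Suc k)
      moreover have "T (g (e k)) \<in> V" by (simp add: V_def)
      ultimately show ?case unfolding e_Suc using subV subspace_diff by blast
    qed (simp add: e_def y)
    have ne: "norm (e k) \<le> norm y * (1 / 2) ^ k" for k
    proof (induction k)
      case (Suc k)
      then show ?case using g(2)[OF eV[of k]] by (simp add: e_Suc)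
    qed (simp add: e_def)
    have ng: "norm (g (e k)) \<le> (4 * n / r * norm y) * (1 / 2) ^ k" for k
    proof -
      have "norm (g (e k)) \<le> (4 * n / r) * norm (e k)" by (rule g(1)[OF eV])
      also have "\<dots> \<le> (4 * n / r) * (norm y * (1 / 2) ^ k)"
        using ne r by (intro mult_left_mono) auto
      finally show ?thesis by simp
    qed
    have sm: "summable (\<lambda>k. (4 * n / r * norm y) * (1 / 2 :: real) ^ k)"
      by (intro summable_mult summable_geometric) simp
    have sg: "summable (\<lambda>k. norm (g (e k)))"
      by (rule summable_comparison_test'[OF sm, of 0]) (use ng in auto)
    define x where "x = (\<Sum>k. g (e k))"
    have "norm x \<le> (\<Sum>k. norm (g (e k)))" unfolding x_def by (rule summable_norm[OF sg])
    also have "\<dots> \<le> (\<Sum>k. (4 * n / r * norm y) * (1 / 2) ^ k)"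
      by (rule suminf_le[OF ng sg sm])
    also have "\<dots> = (4 * n / r * norm y) * 2"
      by (subst suminf_mult) (simp_all add: suminf_geometric)
    also have "\<dots> \<le> (8 * n / r + 1) * norm y" by (simp add: algebra_simps)
    finally have 1: "norm x \<le> (8 * n / r + 1) * norm y" .
    have "e \<longlonglongrightarrow> 0"
    proof (rule Lim_null_comparison)
      show "\<forall>\<^sub>F k in sequentially. norm (e k) \<le> norm y * (1 / 2) ^ k" using ne by simp
      show "(\<lambda>k. norm y * (1 / 2 :: real) ^ k) \<longlonglongrightarrow> 0"
        by (intro tendsto_mult_right_zero LIMSEQ_realpow_zero) auto
    qed
    then have "(\<lambda>k. e k - e (Suc k)) sums (e 0 - 0)" by (rule telescope_sums')
    moreover have "(\<lambda>k. e k - e (Suc k)) sums T x"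
      unfolding e_Suc x_def using T.sums[OF summable_sums[OF summable_norm_cancel[OF sg]]] by simp
    ultimately have "T x = y" using sums_unique2 by (fastforce simp: e_def)
    with 1 show "\<exists>x. T x = y \<and> norm x \<le> (8 * n / r + 1) * norm y" by blast
  qed
qed

text \<open>Solving \<open>F x + G x = y\<close> is a fixed point problem for
  \<open>\<lambda>x. h (y - G x)\<close>, where \<open>h\<close> is any choice of preimages in
  \<open>V\<close>. The lower bound on \<open>F\<close> gives \<open>h\<close> the Lipschitz
  constant \<open>1 / e\<close>, so the map contracts by \<open>k / e\<close>.\<close>

lemma surj_on_perturb:
  fixes F G :: "'a::banach \<Rightarrow> 'a"
  assumes V: "closed V" "subspace V"
    and F: "bounded_linear F" "F ` V = V" "\<And>x. x \<in> V \<Longrightarrow> e * norm x \<le> norm (F x)"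
    and G: "bounded_linear G" "G ` V \<subseteq> V" "\<And>x. x \<in> V \<Longrightarrow> norm (G x) \<le> k * norm x"
    and ke: "0 \<le> k" "k < e"
  shows "(\<lambda>x. F x + G x) ` V = V"
proof
  interpret F: bounded_linear F by fact
  interpret G: bounded_linear G by fact
  show "(\<lambda>x. F x + G x) ` V \<subseteq> V"
    using F(2) G(2) V(2) by (auto intro!: subspace_add)
  show "V \<subseteq> (\<lambda>x. F x + G x) ` V"
  proof
    fix y assume y: "y \<in> V"
    have "\<forall>z\<in>V. \<exists>x\<in>V. F x = z" using F(2) by (metis imageE)
    then obtain h where h: "\<And>z. z \<in> V \<Longrightarrow> h z \<in> V" "\<And>z. z \<in> V \<Longrightarrow> F (h z) = z" by metis
    have yG: "y - G x \<in> V" if "x \<in> V" for x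
      using that y G(2) V(2) by (auto intro!: subspace_diff)
    have "\<exists>!x\<in>V. h (y - G x) = x"
    proof (rule Banach_fix[where c = "k / e"])
      show "complete V" "V \<noteq> {}" using V y by (auto simp: complete_eq_closed)
      show "0 \<le> k / e" "k / e < 1" using ke by auto
      show "(\<lambda>x. h (y - G x)) ` V \<subseteq> V" using h yG by auto
      fix a b assume ab: "a \<in> V" "b \<in> V"
      define u where "u = h (y - G a) - h (y - G b)"
      have "u \<in> V" using ab h yG V(2) by (auto simp: u_def intro!: subspace_diff)
      have "F u = G (b - a)" using ab h yG by (simp add: u_def F.diff G.diff)
      then have "e * norm u \<le> k * norm (b - a)"
        using F(3)[OF \<open>u \<in> V\<close>] G(3)[of "b - a"] ab V(2) by (auto simp: subspace_diff)
      then show "dist (h (y - G a)) (h (y - G b)) \<le> k / e * dist a b"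
        using ke by (simp add: u_def dist_norm norm_minus_commute field_simps)
    qed
    then obtain x where x: "x \<in> V" "h (y - G x) = x" by blast
    then have "F x = y - G x" using h(2) yG by metis
    then show "y \<in> (\<lambda>x. F x + G x) ` V" using x(1) by (auto intro!: image_eqI[of _ _ x])
  qed
qed

section \<open>Self-adjoint operators on Hilbert modules\<close>

lemma scaleC_zero_left [simp]: "0 *\<^sub>C x = 0"
  and scaleC_one [simp]: "1 *\<^sub>C x = x"
  for x :: "'a::complex_normed_vector"
  using scaleC_of_real[of 0 x] scaleC_of_real[of 1 x] by simp_all

lemma scaleC_minus_left: "(- c) *\<^sub>C x = - (c *\<^sub>C x)"
  and scaleC_zero_right [simp]: "c *\<^sub>C (0 :: 'a) = 0"
  for x :: "'a::complex_normed_vector"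
  using scaleC_add_left[of "- c" c x] scaleC_add_right[of c 0 0]
  by (simp_all add: eq_neg_iff_add_eq_0)

lemma scaleC_minus_right: "c *\<^sub>C (- x) = - (c *\<^sub>C x)"
  for x :: "'a::complex_normed_vector"
  using scaleC_add_right[of c "- x" x] by (simp add: eq_neg_iff_add_eq_0)

lemma scaleC_diff_right: "c *\<^sub>C (x - y) = c *\<^sub>C x - c *\<^sub>C y"
  for x :: "'a::complex_normed_vector"
  by (simp add: scaleC_add_right scaleC_minus_right flip: add_uminus_conv_diff)

lemma scaleC_scaleR: "c *\<^sub>C (r *\<^sub>R x) = r *\<^sub>R (c *\<^sub>C x)"
  for x :: "'a::complex_normed_vector"
  by (simp add: scaleC_scaleC mult.commute flip: scaleC_of_real)

lemma bounded_linear_scaleC: "bounded_linear (\<lambda>x :: 'a::complex_normed_vector. c *\<^sub>C x)"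
  by (rule bounded_linear_intro[of _ "cmod c"])
    (simp_all add: scaleC_add_right scaleC_scaleR norm_scaleC mult.commute)

lemma star_zero [simp]: "(0 :: 'b::cstar_algebra)\<^sup>\<star> = 0"
  using star_add[of 0 "0 :: 'b"] by simp

lemma star_eq_0_iff [simp]: "(b :: 'b::cstar_algebra)\<^sup>\<star> = 0 \<longleftrightarrow> b = 0"
  by (metis star_star star_zero)

context hilbert_module
begin

lemma ip_add_left: "ip (x + y) z = ip x z + ip y z"
  by (simp add: ip_star[where x = z] ip_add_right star_add)

lemma ip_scaleC_left: "ip (c *\<^sub>C x) z = cnj c *\<^sub>C ip x z"
  by (metis ip_scaleC_right ip_star star_scaleC)

lemma ip_scaleR_right: "ip x (r *\<^sub>R y) = r *\<^sub>R ip x y"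
  using ip_scaleC_right[of x "complex_of_real r" y] by (simp add: scaleC_of_real)

lemma ip_scaleR_left: "ip (r *\<^sub>R x) y = r *\<^sub>R ip x y"
  using ip_scaleC_left[of "complex_of_real r" x y] by (simp add: scaleC_of_real)

lemma norm_ip_self: "norm (ip x x) = (norm x)\<^sup>2"
  by (simp add: norm_ip)

lemma norm_add_scaleC_le: "cmod c = 1 \<Longrightarrow> norm (x + c *\<^sub>C y) \<le> norm x + norm y"
  by (metis mult_1 norm_scaleC norm_triangle_ineq)

text \<open>Polarisation over 1, i, -1, -i bounds \<open>ip x y\<close> by the square of
  \<open>norm x + norm y\<close>, which is 4 for unit vectors.\<close>

lemma ip_bound: "norm (ip x y) \<le> 4 * norm x * norm y"
proof (cases "x = 0 \<or> y = 0")
  case True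
  then show ?thesis
    using ip_add_left[of 0 0 y] ip_add_right[of x 0 0] by auto
next
  case False
  have *: "norm (ip x y) \<le> (norm x + norm y)\<^sup>2" for x y
  proof -
    define q where "q c = cnj c *\<^sub>C ip (x + c *\<^sub>C y) (x + c *\<^sub>C y)" for c
    have q: "q c = cnj c *\<^sub>C ip x x + (cnj c * c) *\<^sub>C ip x y + (cnj c * cnj c) *\<^sub>C ip y x
        + (cnj c * cnj c * c) *\<^sub>C ip y y" for c
      by (simp add: q_def ip_add_left ip_add_right ip_scaleC_left ip_scaleC_right
          scaleC_add_right scaleC_scaleC add_ac mult_ac)
    have "q 1 + q \<i> + q (- 1) + q (- \<i>) = 4 *\<^sub>R ip x y"
      using scaleR_left_distrib[of 2 2 "ip x y"]
      by (simp add: q scaleC_minus_left scaleR_2 add.assoc)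
    then have "4 * norm (ip x y) = norm (q 1 + q \<i> + q (- 1) + q (- \<i>))" by simp
    also have "\<dots> \<le> norm (q 1) + norm (q \<i>) + norm (q (- 1)) + norm (q (- \<i>))"
      by (smt (verit) norm_triangle_ineq)
    also have "\<dots> \<le> 4 * (norm x + norm y)\<^sup>2"
    proof -
      have "norm (q c) \<le> (norm x + norm y)\<^sup>2" if "cmod c = 1" for c
        using norm_add_scaleC_le[OF that, of x y] that
        by (simp add: q_def norm_scaleC norm_ip_self power_mono)
      from this[of 1] this[of \<i>] this[of "- 1"] this[of "- \<i>"] show ?thesis by simp
    qed
    finally show ?thesis by simp
  qed
  have "norm (ip (x /\<^sub>R norm x) (y /\<^sub>R norm y)) \<le> (1 + 1)\<^sup>2"
    using *[of "x /\<^sub>R norm x" "y /\<^sub>R norm y"] False by simp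
  then show ?thesis
    using False by (simp add: ip_scaleR_left ip_scaleR_right field_simps)
qed

sublocale ip: bounded_bilinear ip
  by unfold_locales
    (auto simp: ip_add_left ip_add_right ip_scaleR_left ip_scaleR_right mult_ac
      intro!: exI[of _ 4] order_trans[OF ip_bound])

lemma ip_commute_0: "ip x y = 0 \<longleftrightarrow> ip y x = 0"
  by (metis ip_star star_eq_0_iff)

lemma ip_self_eq_0 [simp]: "ip x x = 0 \<longleftrightarrow> x = 0"
  by (metis ip.zero_left norm_eq_zero norm_ip_self power2_eq_square mult_eq_0_iff)

lemma ip_ext: "(\<And>z. ip x z = ip y z) \<Longrightarrow> x = y"
  using ip_self_eq_0[of "x - y"] by (simp add: ip.diff_left del: ip_self_eq_0)

lemma norm_eq_if_ip_eq: "ip x x = ip y y \<Longrightarrow> norm x = norm y"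
  by (simp add: norm_ip)

definition selfadjoint :: "('x \<Rightarrow>\<^sub>L 'x) \<Rightarrow> bool"
  where "selfadjoint T \<longleftrightarrow> (\<forall>x y. ip (T x) y = ip x (T y))"

definition commutes :: "('x \<Rightarrow>\<^sub>L 'x) \<Rightarrow> ('x \<Rightarrow>\<^sub>L 'x) \<Rightarrow> bool"
  where "commutes S T \<longleftrightarrow> (\<forall>x. S (T x) = T (S x))"

lemma selfadjointD: "selfadjoint T \<Longrightarrow> ip (T x) y = ip x (T y)"
  by (simp add: selfadjoint_def)

lemma commutesD: "commutes S T \<Longrightarrow> S (T x) = T (S x)"
  by (simp add: commutes_def)

lemma commutes_sym: "commutes S T \<Longrightarrow> commutes T S"
  by (simp add: commutes_def)

lemma selfadjoint_scaleC: "selfadjoint T \<Longrightarrow> T (c *\<^sub>C x) = c *\<^sub>C T x"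
  by (rule ip_ext) (simp add: selfadjointD ip_scaleC_left)

lemma selfadjoint_intros:
  "selfadjoint id_blinfun" "selfadjoint 0"
  "selfadjoint S \<Longrightarrow> selfadjoint T \<Longrightarrow> selfadjoint (S + T)"
  "selfadjoint S \<Longrightarrow> selfadjoint T \<Longrightarrow> selfadjoint (S - T)"
  "selfadjoint T \<Longrightarrow> selfadjoint (r *\<^sub>R T)"
  "selfadjoint S \<Longrightarrow> selfadjoint T \<Longrightarrow> commutes S T \<Longrightarrow> selfadjoint (S o\<^sub>L T)"
  "selfadjoint S \<Longrightarrow> selfadjoint T \<Longrightarrow> selfadjoint (S o\<^sub>L T o\<^sub>L S)"
  by (auto simp: selfadjoint_def commutes_def blinfun.bilinear_simps
      ip.add_left ip.add_right ip.diff_left ip.diff_right ip_scaleR_left ip_scaleR_right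
      ip.zero_left ip.zero_right)

lemma commutes_intros:
  "commutes B id_blinfun" "commutes B 0" "commutes B B"
  "commutes B S \<Longrightarrow> commutes B T \<Longrightarrow> commutes B (S + T)"
  "commutes B S \<Longrightarrow> commutes B T \<Longrightarrow> commutes B (S - T)"
  "commutes B T \<Longrightarrow> commutes B (r *\<^sub>R T)"
  "commutes B S \<Longrightarrow> commutes B T \<Longrightarrow> commutes B (S o\<^sub>L T)"
  by (simp_all add: commutes_def blinfun.bilinear_simps)

text \<open>For commuting self-adjoint \<open>S\<close> and \<open>T\<close> the vectors \<open>S x \<plusminus> i T x\<close> have the same
  inner square \<open>\<langle>x, (S\<^sup>2 + T\<^sup>2) x\<rangle>\<close>, and \<open>S x\<close> is their mean.\<close>

lemma norm_le_sum_squares: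
  assumes "selfadjoint S" "selfadjoint T" "commutes S T"
  shows "(norm (S x))\<^sup>2 \<le> norm (ip x (S (S x) + T (T x)))"
proof -
  have *: "ip (S x + c *\<^sub>C T x) (S x + c *\<^sub>C T x) = ip x (S (S x) + T (T x))" if "c = \<i> \<or> c = - \<i>" for c
  proof -
    have "ip (T x) (S x) = ip x (T (S x))" using assms(2) by (rule selfadjointD)
    also have "\<dots> = ip x (S (T x))" using assms(3) by (simp add: commutes_def)
    also have "\<dots> = ip (S x) (T x)" using assms(1) by (rule selfadjointD[symmetric])
    finally have "ip (T x) (S x) = ip (S x) (T x)" .
    then have "ip (S x + c *\<^sub>C T x) (S x + c *\<^sub>C T x)
        = ip (S x) (S x) + (c + cnj c) *\<^sub>C ip (S x) (T x) + (cnj c * c) *\<^sub>C ip (T x) (T x)"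
      by (simp add: ip_add_left ip_add_right ip_scaleC_left ip_scaleC_right scaleC_scaleC
          scaleC_add_left scaleC_add_right mult.commute)
    also have "\<dots> = ip (S x) (S x) + ip (T x) (T x)" using that by auto
    finally show ?thesis
      by (simp add: ip_add_right selfadjointD[OF assms(1)] selfadjointD[OF assms(2)])
  qed
  define r where "r = sqrt (norm (ip x (S (S x) + T (T x))))"
  have "norm (2 *\<^sub>R S x) = norm ((S x + \<i> *\<^sub>C T x) + (S x + (- \<i>) *\<^sub>C T x))"
    by (simp add: scaleC_minus_left scaleR_2)
  also have "\<dots> \<le> r + r"
    unfolding r_def by (rule order_trans[OF norm_triangle_ineq]) (simp add: norm_ip *)
  finally have "norm (S x) \<le> r" by simp
  then have "(norm (S x))\<^sup>2 \<le> r\<^sup>2" by (intro power_mono) auto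
  then show ?thesis by (simp add: r_def)
qed

end

section \<open>Limits, square roots and absolute values of self-adjoint operators\<close>

lemma norm_blinfun_power2_le:
  assumes "0 \<le> b" "\<And>x. (norm (blinfun_apply S x))\<^sup>2 \<le> b * (norm x)\<^sup>2"
  shows "(norm S)\<^sup>2 \<le> b"
proof -
  have "norm (S x) \<le> sqrt b * norm x" for x
    using assms(2)[of x] real_le_rsqrt by (fastforce simp: real_sqrt_mult)
  then have "norm S \<le> sqrt b" by (intro norm_blinfun_bound) (auto simp: assms)
  then have "(norm S)\<^sup>2 \<le> (sqrt b)\<^sup>2" by (intro power_mono) auto
  then show ?thesis using assms(1) by simp
qed

context hilbert_module
begin

lemma selfadjoint_LIMSEQ:
  assumes "e \<longlonglongrightarrow> E" "\<And>n. selfadjoint (e n)"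
  shows "selfadjoint E"
  unfolding selfadjoint_def
proof (intro allI)
  fix x y
  have *: "(\<lambda>n. e n z) \<longlonglongrightarrow> E z" for z using assms(1) by (rule blinfun.tendsto) simp
  have "(\<lambda>n. ip (e n x) y) \<longlonglongrightarrow> ip (E x) y" by (intro ip.tendsto * tendsto_const)
  moreover have "(\<lambda>n. ip (e n x) y) \<longlonglongrightarrow> ip x (E y)"
    unfolding selfadjointD[OF assms(2)] by (intro ip.tendsto * tendsto_const)
  ultimately show "ip (E x) y = ip x (E y)" by (rule LIMSEQ_unique)
qed

lemma commutes_LIMSEQ:
  assumes "e \<longlonglongrightarrow> E" "\<And>n. commutes B (e n)"
  shows "commutes B E"
  unfolding commutes_def
proof
  fix x
  have *: "(\<lambda>n. e n z) \<longlonglongrightarrow> E z" for z using assms(1) by (rule blinfun.tendsto) simp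
  have "(\<lambda>n. B (e n x)) \<longlonglongrightarrow> B (E x)" by (intro blinfun.tendsto * tendsto_const)
  moreover have "(\<lambda>n. B (e n x)) \<longlonglongrightarrow> E (B x)"
    unfolding commutesD[OF assms(2)] by (rule *)
  ultimately show "B (E x) = E (B x)" by (rule LIMSEQ_unique)
qed

text \<open>With \<open>C = 1 - A\<close> the root is \<open>1 - E\<close> for the limit \<open>E\<close> of \<open>E\<^sub>0 = 0\<close>,
  \<open>E\<^sub>n\<^sub>+\<^sub>1 = (C + E\<^sub>n\<^sup>2) / 2\<close>. The increments are dominated by those of the scalar iteration for
  \<open>C = 1\<close>, which is increasing and bounded.\<close>

lemma selfadjoint_root:
  assumes "selfadjoint A" "norm (id_blinfun - A) \<le> 1"
  obtains W where "selfadjoint W" "\<And>x. W (W x) = A x" "norm (id_blinfun - W) \<le> 1"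
    "\<And>B. commutes B A \<Longrightarrow> commutes B W"
proof -
  define C where "C = id_blinfun - A"
  have C: "selfadjoint C" "norm C \<le> 1"
    using assms by (auto simp: C_def intro: selfadjoint_intros)
  \<comment> \<open>For W = 1 - E the equation W^2 = A reads 2 E = C + E^2, which is the fixed point
    equation of this iteration.\<close>
  define e where "e = rec_nat (0 :: 'x \<Rightarrow>\<^sub>L 'x) (\<lambda>_ E. (1 / 2) *\<^sub>R (C + (E o\<^sub>L E)))"
  define s where "s = rec_nat (0 :: real) (\<lambda>_ t. (1 + t\<^sup>2) / 2)"
  have e: "e 0 = 0" "e (Suc n) = (1 / 2) *\<^sub>R (C + (e n o\<^sub>L e n))" for n by (simp_all add: e_def)
  have s: "s 0 = 0" "s (Suc n) = (1 + (s n)\<^sup>2) / 2" for n by (simp_all add: s_def)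
  have s01: "0 \<le> s n \<and> s n \<le> 1" for n
    by (induction n) (auto simp: s power_le_one)
  have s_mono: "s n \<le> s (Suc n)" for n
    using sum_squares_ge_zero[of "s n - 1" 0] by (simp add: s power2_eq_square field_simps)
  have "incseq s" using s_mono by (rule incseq_SucI)
  moreover have "\<bar>s n\<bar> \<le> 1" for n using s01[of n] by simp
  then have "Bseq s" by (intro BseqI'[of s 1]) simp
  ultimately obtain l where l: "s \<longlonglongrightarrow> l" by (meson convergent_def Bseq_monoseq_convergent incseq_imp_monoseq)
  have norm_e: "norm (e n) \<le> s n" for n
  proof (induction n)
    case (Suc n)
    have "norm (e (Suc n)) \<le> (norm C + norm (e n o\<^sub>L e n)) / 2"
      by (simp add: e norm_triangle_ineq)
    also have "\<dots> \<le> (1 + norm (e n) * norm (e n)) / 2"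
      using C(2) norm_blinfun_compose[of "e n" "e n"] by simp
    also have "\<dots> \<le> (1 + s n * s n) / 2"
      using Suc s01[of n] mult_mono[OF Suc Suc] by simp
    finally show ?case by (simp add: s power2_eq_square)
  qed (simp add: e s)
  have diff_e: "norm (e (Suc n) - e n) \<le> s (Suc n) - s n" for n
  proof (induction n)
    case 0
    then show ?case using C(2) by (simp add: e s)
  next
    case (Suc n)
    let ?d = "e (Suc n) - e n"
    have "e (Suc (Suc n)) - e (Suc n) = (1 / 2) *\<^sub>R ((e (Suc n) o\<^sub>L e (Suc n)) - (e n o\<^sub>L e n))"
      unfolding e(2)[of "Suc n"] e(2)[of n] by (simp add: algebra_simps)
    also have "\<dots> = (1 / 2) *\<^sub>R ((e (Suc n) o\<^sub>L ?d) + (?d o\<^sub>L e n))"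
      by (simp add: bounded_bilinear.diff_left[OF bounded_bilinear_blinfun_compose]
          bounded_bilinear.diff_right[OF bounded_bilinear_blinfun_compose])
    finally have "norm (e (Suc (Suc n)) - e (Suc n)) \<le> (norm (e (Suc n) o\<^sub>L ?d) + norm (?d o\<^sub>L e n)) / 2"
      by (simp add: norm_triangle_ineq)
    also have "\<dots> \<le> (norm (e (Suc n)) * norm ?d + norm ?d * norm (e n)) / 2"
      by (intro divide_right_mono add_mono norm_blinfun_compose) simp
    also have "\<dots> \<le> (s (Suc n) * (s (Suc n) - s n) + (s (Suc n) - s n) * s n) / 2"
      by (intro divide_right_mono add_mono mult_mono norm_e Suc) (use s01 s_mono in auto)
    also have "\<dots> = ((s (Suc n))\<^sup>2 - (s n)\<^sup>2) / 2" by (simp add: power2_eq_square algebra_simps)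
    also have "\<dots> = s (Suc (Suc n)) - s (Suc n)" using s(2)[of "Suc n"] s(2)[of n] by argo
    finally show ?case .
  qed
  have "summable (\<lambda>n. norm (e (Suc n) - e n))"
    by (rule summable_comparison_test'[OF telescope_summable[OF l], of 0]) (use diff_e in auto)
  then have "(\<lambda>n. \<Sum>k<n. e (Suc k) - e k) \<longlonglongrightarrow> (\<Sum>k. e (Suc k) - e k)"
    by (rule summable_LIMSEQ[OF summable_norm_cancel])
  then obtain E where E: "e \<longlonglongrightarrow> E" unfolding sum_lessThan_telescope by (auto simp: e(1))
  have "(\<lambda>n. (1 / 2) *\<^sub>R (C + (e n o\<^sub>L e n))) \<longlonglongrightarrow> (1 / 2) *\<^sub>R (C + (E o\<^sub>L E))"
    by (intro tendsto_intros bounded_bilinear.tendsto[OF bounded_bilinear_blinfun_compose] E)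
  moreover have "(\<lambda>n. (1 / 2) *\<^sub>R (C + (e n o\<^sub>L e n))) \<longlonglongrightarrow> E"
    using LIMSEQ_Suc[OF E] by (simp add: e)
  ultimately have EE: "E = (1 / 2) *\<^sub>R (C + (E o\<^sub>L E))" by (rule LIMSEQ_unique[symmetric])
  have E2': "2 *\<^sub>R E = C + (E o\<^sub>L E)" by (subst EE) simp
  have E2: "E (E x) = E x + E x - C x" for x
    using arg_cong[OF E2', of "\<lambda>T. blinfun_apply T x"] by (simp add: blinfun.bilinear_simps scaleR_2)
  have sae: "selfadjoint (e n)" for n
    by (induction n) (auto simp: e intro!: selfadjoint_intros C commutes_intros)
  show thesis
  proof
    show "selfadjoint (id_blinfun - E)"
      by (intro selfadjoint_intros selfadjoint_LIMSEQ[OF E] sae)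
    show "(id_blinfun - E) ((id_blinfun - E) x) = A x" for x
      by (simp add: blinfun.bilinear_simps E2 C_def)
    have "norm E \<le> 1"
      by (rule Lim_bounded[OF tendsto_norm[OF E], of 0]) (use norm_e s01 order_trans in blast)
    then show "norm (id_blinfun - (id_blinfun - E)) \<le> 1" by simp
    fix B assume B: "commutes B A"
    have "commutes B (e n)" for n
      by (induction n) (auto simp: e C_def intro!: commutes_intros B)
    then show "commutes B (id_blinfun - E)"
      by (intro commutes_intros commutes_LIMSEQ[OF E])
  qed
qed

lemma norm_le_if_sum_squares:
  assumes "selfadjoint S" "selfadjoint T" "commutes S T" "\<And>x. S (S x) + T (T x) = c *\<^sub>R x"
  shows "(norm S)\<^sup>2 \<le> \<bar>c\<bar>"
proof (rule norm_blinfun_power2_le)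
  fix x
  show "(norm (S x))\<^sup>2 \<le> \<bar>c\<bar> * (norm x)\<^sup>2"
    using norm_le_sum_squares[OF assms(1-3), of x]
    by (simp add: assms(4) ip_scaleR_right norm_ip_self)
qed simp

text \<open>With c the norm of S^2, the operator 1 - S^2 / c has a root W, and S^2 + c W^2 = c
  bounds S. This is the sharp C*-identity for self-adjoint operators, out of reach of
  \<open>ip_bound\<close>.\<close>

lemma norm_selfadjoint_square:
  assumes S: "selfadjoint S"
  shows "(norm S)\<^sup>2 \<le> norm (S o\<^sub>L S)"
proof (cases "S o\<^sub>L S = 0")
  case True
  then have "S (S x) = 0" for x by (metis blinfun_apply_blinfun_compose blinfun.zero_left)
  then have "(norm S)\<^sup>2 \<le> \<bar>0\<bar>"
    using S by (intro norm_le_if_sum_squares[of _ 0]) (auto intro: selfadjoint_intros commutes_intros)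
  then show ?thesis by simp
next
  case False
  define c where "c = norm (S o\<^sub>L S)"
  have c: "c > 0" using False by (simp add: c_def)
  have "selfadjoint (id_blinfun - (1 / c) *\<^sub>R (S o\<^sub>L S))"
    using S by (intro selfadjoint_intros commutes_intros)
  moreover have "norm (id_blinfun - (id_blinfun - (1 / c) *\<^sub>R (S o\<^sub>L S))) \<le> 1"
    using c by (simp add: c_def)
  ultimately obtain W where W: "selfadjoint W" "\<And>x. W (W x) = (id_blinfun - (1 / c) *\<^sub>R (S o\<^sub>L S)) x"
      "\<And>B. commutes B (id_blinfun - (1 / c) *\<^sub>R (S o\<^sub>L S)) \<Longrightarrow> commutes B W"
    by (rule selfadjoint_root) blast
  have "(norm S)\<^sup>2 \<le> \<bar>c\<bar>"
  proof (rule norm_le_if_sum_squares)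
    show "selfadjoint (sqrt c *\<^sub>R W)" using W(1) by (rule selfadjoint_intros)
    show "commutes S (sqrt c *\<^sub>R W)" by (intro commutes_intros W(3))
    show "S (S x) + (sqrt c *\<^sub>R W) ((sqrt c *\<^sub>R W) x) = c *\<^sub>R x" for x
      using c by (simp add: blinfun.bilinear_simps W(2) scaleR_right_diff_distrib)
  qed (rule S)
  then show ?thesis using c by (simp add: c_def)
qed

text \<open>\<open>G\<close> is the absolute value of \<open>S\<close> and \<open>K\<close> its
  root. The second extraction is possible because \<open>selfadjoint_root\<close> also keeps 1 minus
  the root a contraction.\<close>

lemma absolute_value_root:
  assumes S: "selfadjoint S"
  obtains G K where "selfadjoint G" "selfadjoint K" "\<And>x. G (G x) = S (S x)" "\<And>x. K (K x) = G x"
    "\<And>B. commutes B S \<Longrightarrow> commutes B G" "\<And>B. commutes B S \<Longrightarrow> commutes B K"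
proof (cases "S o\<^sub>L S = 0")
  case True
  then have "S (S x) = 0" for x by (metis blinfun_apply_blinfun_compose blinfun.zero_left)
  then show thesis
    by (intro that[of 0 0] selfadjoint_intros commutes_intros) (simp_all add: blinfun.zero_left)
next
  case False
  define c where "c = norm (S o\<^sub>L S)"
  have c: "c > 0" using False by (simp add: c_def)
  define A where "A = (1 / c) *\<^sub>R (S o\<^sub>L S)"
  have saA: "selfadjoint A" unfolding A_def using S by (intro selfadjoint_intros commutes_intros)
  have commA: "commutes B A" if "commutes B S" for B
    unfolding A_def using that by (intro commutes_intros)
  have "norm (id_blinfun - (id_blinfun - A)) \<le> 1" using c by (simp add: A_def c_def)
  then obtain W where W: "selfadjoint W" "\<And>x. W (W x) = (id_blinfun - A) x"
      "\<And>B. commutes B (id_blinfun - A) \<Longrightarrow> commutes B W"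
    using saA by (metis selfadjoint_root selfadjoint_intros(1,4))
  \<comment> \<open>A root of \<open>A\<close> requires 1 - A to be a contraction, whereas so far
    only \<open>A\<close> is known to be one. The identity W^2 + A = 1 bounds \<open>W\<close>, and
    hence 1 - A = W^2.\<close>
  have "(norm W)\<^sup>2 \<le> \<bar>1\<bar>"
  proof (rule norm_le_if_sum_squares)
    show "selfadjoint ((1 / sqrt c) *\<^sub>R S)" using S by (rule selfadjoint_intros)
    show "commutes W ((1 / sqrt c) *\<^sub>R S)"
      by (intro commutes_intros commutes_sym[OF W(3)] commA)
    show "W (W x) + ((1 / sqrt c) *\<^sub>R S) (((1 / sqrt c) *\<^sub>R S) x) = 1 *\<^sub>R x" for x
      using c by (simp add: blinfun.bilinear_simps W(2) A_def)
  qed (rule W)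
  moreover have "id_blinfun - A = W o\<^sub>L W" by (rule blinfun_eqI) (simp add: W(2))
  ultimately have "norm (id_blinfun - A) \<le> 1"
    using norm_blinfun_compose[of W W] by (simp add: power2_eq_square)
  then obtain G where G: "selfadjoint G" "\<And>x. G (G x) = A x" "norm (id_blinfun - G) \<le> 1"
      "\<And>B. commutes B A \<Longrightarrow> commutes B G"
    using saA selfadjoint_root by blast
  obtain K where K: "selfadjoint K" "\<And>x. K (K x) = G x" "\<And>B. commutes B G \<Longrightarrow> commutes B K"
    by (rule selfadjoint_root[OF G(1,3)]) blast
  show thesis
  proof (rule that[of "sqrt c *\<^sub>R G" "sqrt (sqrt c) *\<^sub>R K"])
    show "(sqrt c *\<^sub>R G) ((sqrt c *\<^sub>R G) x) = S (S x)" for x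
      using c by (simp add: blinfun.bilinear_simps G(2) A_def)
    show "(sqrt (sqrt c) *\<^sub>R K) ((sqrt (sqrt c) *\<^sub>R K) x) = (sqrt c *\<^sub>R G) x" for x
      using c by (simp add: blinfun.bilinear_simps K(2))
    show "selfadjoint (sqrt c *\<^sub>R G)" "selfadjoint (sqrt (sqrt c) *\<^sub>R K)"
      by (intro selfadjoint_intros G(1) K(1))+
    show "commutes B (sqrt c *\<^sub>R G)" "commutes B (sqrt (sqrt c) *\<^sub>R K)" if "commutes B S" for B
      by (intro commutes_intros K(3) G(4) commA that)+
  qed
qed

text \<open>This is the realness of the spectrum: the shift of \<open>S\<close> by i \<epsilon> is
  bounded below by the modulus of \<epsilon>. It is onto \<open>V\<close> for large \<epsilon>,
  stays onto while \<epsilon> is halved, and at last the lower bound \<delta> on \<open>S\<close>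
  itself allows the shift to be dropped.\<close>

lemma selfadjoint_surj_on:
  assumes V: "closed V" "subspace V" "\<And>c x. x \<in> V \<Longrightarrow> c *\<^sub>C x \<in> V"
    and S: "selfadjoint S" "S ` V \<subseteq> V"
    and \<delta>: "\<delta> > 0" "\<And>x. x \<in> V \<Longrightarrow> \<delta> * norm x \<le> norm (S x)"
  shows "S ` V = V"
proof -
  \<comment> \<open>The shifts by i \<epsilon> and by -i \<epsilon> give vectors with the same inner
    square, hence the same norm, and their difference is 2 i \<epsilon> x.\<close>
  have lower: "\<bar>\<epsilon>\<bar> * norm x \<le> norm (S x + (\<i> * of_real \<epsilon>) *\<^sub>C x)" for \<epsilon> x
  proof -
    have i2: "\<i> * complex_of_real t * (\<i> * of_real t) = - (of_real t * of_real t)" for t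
      by (simp add: algebra_simps)
    have *: "ip (S x + (\<i> * of_real t) *\<^sub>C x) (S x + (\<i> * of_real t) *\<^sub>C x) = ip (S x) (S x) + t\<^sup>2 *\<^sub>R ip x x" for t
      by (simp add: ip_add_left ip_add_right ip_scaleC_left ip_scaleC_right selfadjointD[OF S(1)]
          scaleC_add_right scaleC_diff_right scaleC_minus_left power2_eq_square scaleC_scaleC i2 flip: scaleC_of_real)
    have "2 * \<bar>\<epsilon>\<bar> * norm x = norm ((2 * \<i> * of_real \<epsilon>) *\<^sub>C x)" by (simp add: norm_scaleC norm_mult)
    also have "(2 * \<i> * of_real \<epsilon>) *\<^sub>C x
        = (S x + (\<i> * of_real \<epsilon>) *\<^sub>C x) - (S x + (\<i> * of_real (- \<epsilon>)) *\<^sub>C x)"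
      by (simp add: scaleC_minus_left mult.assoc flip: scaleC_add_left)
    also have "norm \<dots> \<le> norm (S x + (\<i> * of_real \<epsilon>) *\<^sub>C x) + norm (S x + (\<i> * of_real (- \<epsilon>)) *\<^sub>C x)"
      by (rule norm_triangle_ineq4)
    also have "norm (S x + (\<i> * of_real (- \<epsilon>)) *\<^sub>C x) = norm (S x + (\<i> * of_real \<epsilon>) *\<^sub>C x)"
      using *[of \<epsilon>] *[of "- \<epsilon>"] by (intro norm_eq_if_ip_eq) simp
    finally show ?thesis by simp
  qed
  have lin: "bounded_linear (\<lambda>x. S x + c *\<^sub>C x)" for c
    by (intro bounded_linear_add bounded_linear_scaleC blinfun.bounded_linear_right)
  have normS: "norm (S x) \<le> norm S * norm x" for x by (rule norm_blinfun)
  \<comment> \<open>\<open>r 0\<close> exceeds \<open>norm S\<close>, so the scalar part dominates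
    at the start. Halving changes the shift by \<open>r (Suc n)\<close>, which is below the lower
    bound \<open>r n\<close>.\<close>
  define r where "r n = (norm S + 1) / 2 ^ n" for n
  have r: "r n > 0" for n by (simp add: r_def add_nonneg_pos)
  have onto: "(\<lambda>x. S x + (\<i> * of_real (r n)) *\<^sub>C x) ` V = V" for n
  proof (induction n)
    case 0
    have "(\<lambda>x. (\<i> * of_real (r 0)) *\<^sub>C x + S x) ` V = V"
    proof (rule surj_on_perturb[OF V(1,2), where e = "r 0" and k = "norm S"])
      show "(\<lambda>x. (\<i> * of_real (r 0)) *\<^sub>C x) ` V = V"
      proof (intro antisym subsetI)
        fix x assume "x \<in> V"
        then show "x \<in> (\<lambda>x. (\<i> * of_real (r 0)) *\<^sub>C x) ` V"
          using r[of 0] V(3) by (intro image_eqI[of _ _ "(1 / (\<i> * of_real (r 0))) *\<^sub>C x"]) (auto simp: scaleC_scaleC)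
      qed (use V(3) in auto)
    qed (use S(2) in \<open>auto intro: bounded_linear_scaleC blinfun.bounded_linear_right norm_blinfun
        simp: norm_scaleC norm_mult r_def\<close>)
    then show ?case by (simp add: add.commute)
  next
    case (Suc n)
    have "(\<lambda>x. (S x + (\<i> * of_real (r n)) *\<^sub>C x) + (- \<i> * of_real (r (Suc n))) *\<^sub>C x) ` V = V"
    proof (rule surj_on_perturb[OF V(1,2) lin Suc, where e = "r n" and k = "r (Suc n)"])
      show "r n * norm x \<le> norm (S x + (\<i> * of_real (r n)) *\<^sub>C x)" for x
        using lower[of "r n" x] r[of n] by simp
      show "r (Suc n) < r n" using r[of n] by (simp add: r_def)
    qed (use V(3) r[of "Suc n"] in \<open>auto intro: bounded_linear_scaleC simp: norm_scaleC norm_mult\<close>)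
    moreover have "S x + (\<i> * of_real (r n)) *\<^sub>C x + (- \<i> * of_real (r (Suc n))) *\<^sub>C x
        = S x + (\<i> * of_real (r (Suc n))) *\<^sub>C x" for x
      by (simp add: add.assoc r_def flip: scaleC_add_left)
    ultimately show ?case by (simp only:)
  qed
  have "r \<longlonglongrightarrow> 0"
    unfolding r_def by (rule LIMSEQ_divide_realpow_zero) simp
  then obtain n where n: "r n < \<delta> / 2"
    using \<delta>(1) by (metis LIMSEQ_iff abs_less_iff diff_zero half_gt_zero order_refl real_norm_def)
  have "(\<lambda>x. (S x + (\<i> * of_real (r n)) *\<^sub>C x) + (- \<i> * of_real (r n)) *\<^sub>C x) ` V = V"
  proof (rule surj_on_perturb[OF V(1,2) lin onto, where e = "\<delta> - r n" and k = "r n"])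
    fix x assume "x \<in> V"
    have "norm (S x) \<le> norm (S x + (\<i> * of_real (r n)) *\<^sub>C x) + norm ((\<i> * of_real (r n)) *\<^sub>C x)"
      by (metis add_diff_cancel_right' norm_triangle_ineq4)
    then show "(\<delta> - r n) * norm x \<le> norm (S x + (\<i> * of_real (r n)) *\<^sub>C x)"
      using \<delta>(2)[OF \<open>x \<in> V\<close>] r[of n] by (simp add: norm_scaleC norm_mult algebra_simps)
  qed (use V(3) r[of n] n in \<open>auto intro: bounded_linear_scaleC simp: norm_scaleC norm_mult\<close>)
  then show ?thesis by (simp add: scaleC_minus_left)
qed

end

section \<open>Adjoint pairs and the closed range theorem\<close>

lemma subspace_range_blinfun: "subspace (range (blinfun_apply T))"
  using blinfun.bounded_linear_right bounded_linear.linear linear_subspace_image subspace_UNIV by blast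

lemma mem_set_plus_iff: "z \<in> U + V \<longleftrightarrow> (\<exists>u\<in>U. \<exists>v\<in>V. z = u + v)"
  by (simp add: set_plus_def)

context hilbert_module
begin

text \<open>A relation between two given operators, since a bounded operator on a Hilbert module
  need not have an adjoint.\<close>

definition adjoint_pair :: "('x \<Rightarrow>\<^sub>L 'x) \<Rightarrow> ('x \<Rightarrow>\<^sub>L 'x) \<Rightarrow> bool"
  where "adjoint_pair T T' \<longleftrightarrow> (\<forall>x y. ip (T x) y = ip x (T' y))"

lemma adjoint_pairD: "adjoint_pair T T' \<Longrightarrow> ip (T x) y = ip x (T' y)"
  by (simp add: adjoint_pair_def)

lemma adjoint_pair_sym: "adjoint_pair T T' \<Longrightarrow> adjoint_pair T' T"
  unfolding adjoint_pair_def by (metis ip_star)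

lemma adjoint_pair_selfadjoint: "selfadjoint T \<longleftrightarrow> adjoint_pair T T"
  by (simp add: adjoint_pair_def selfadjoint_def)

lemma adjoint_pair_compose:
  "adjoint_pair S S' \<Longrightarrow> adjoint_pair T T' \<Longrightarrow> adjoint_pair (S o\<^sub>L T) (T' o\<^sub>L S')"
  by (simp add: adjoint_pair_def)

lemma adjoint_pair_diff:
  "adjoint_pair S S' \<Longrightarrow> adjoint_pair T T' \<Longrightarrow> adjoint_pair (S - T) (S' - T')"
  by (simp add: adjoint_pair_def blinfun.bilinear_simps ip.diff_left ip.diff_right)

lemma adjoint_pair_scaleC: "adjoint_pair T T' \<Longrightarrow> T (c *\<^sub>C x) = c *\<^sub>C T x"
  by (rule ip_ext) (simp add: adjoint_pairD ip_scaleC_left)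

lemma norm_adjoint_le: "adjoint_pair T T' \<Longrightarrow> (norm (T' y))\<^sup>2 \<le> 4 * norm y * norm (T (T' y))"
  by (metis adjoint_pairD adjoint_pair_sym ip_bound norm_ip_self)

text \<open>Bounded preimages under \<open>T\<close> make \<open>T'\<close> bounded below on the
  range of \<open>T\<close>, hence also T T', which is self-adjoint and so maps this range onto
  itself. Solving T T' T y = T T' x then exhibits \<open>X\<close> as the range of \<open>T\<close>
  plus the kernel of \<open>T'\<close>; this third conclusion is the source of the later
  complements.\<close>

theorem adjoint_closed_range:
  assumes adj: "adjoint_pair T T'" and cl: "closed (range T)"
  shows "\<exists>\<delta>>0. \<forall>y\<in>range T. \<delta> * norm y \<le> norm (T (T' y))"
    and "y \<in> range T \<Longrightarrow> \<exists>v\<in>range T. T (T' v) = y"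
    and "\<exists>y. T' (x - T y) = 0"
    and "closed (range T')"
proof -
  define V where "V = range T"
  have sV: "subspace V" unfolding V_def by (rule subspace_range_blinfun)
  obtain C where C: "C > 0" "\<And>y. y \<in> V \<Longrightarrow> \<exists>x. T x = y \<and> norm x \<le> C * norm y"
    using open_mapping_closed_range[OF blinfun.bounded_linear_right cl] unfolding V_def by blast
  have low: "norm y \<le> 4 * C * norm (T' y)" if y: "y \<in> V" for y
  proof (cases "y = 0")
    case False
    obtain x where x: "T x = y" "norm x \<le> C * norm y" using C(2) y by blast
    have "(norm y)\<^sup>2 = norm (ip x (T' y))" by (metis x(1) adjoint_pairD adj norm_ip_self)
    also have "\<dots> \<le> 4 * norm x * norm (T' y)" by (rule ip_bound)
    also have "\<dots> \<le> 4 * (C * norm y) * norm (T' y)" by (intro mult_right_mono mult_left_mono x) auto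
    finally show ?thesis using False by (simp add: power2_eq_square mult_ac)
  qed simp
  \<comment> \<open>The constant is \<open>4 * C\<close> from \<open>low\<close> times
    \<open>16 * C\<close>, the latter from \<open>low\<close> inserted into
    \<open>norm_adjoint_le\<close>.\<close>
  have low2: "norm y \<le> 64 * C\<^sup>2 * norm (T (T' y))" if y: "y \<in> V" for y
  proof (cases "T' y = 0")
    case False
    have "(norm (T' y))\<^sup>2 \<le> 4 * norm y * norm (T (T' y))" by (rule norm_adjoint_le[OF adj])
    also have "\<dots> \<le> 4 * (4 * C * norm (T' y)) * norm (T (T' y))"
      by (intro mult_right_mono mult_left_mono low y) auto
    finally have "norm (T' y) \<le> 16 * C * norm (T (T' y))" using False by (simp add: power2_eq_square mult_ac)
    then have "4 * C * norm (T' y) \<le> 4 * C * (16 * C * norm (T (T' y)))"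
      using C(1) by (intro mult_left_mono) auto
    then show ?thesis using low[OF y] by (simp add: power2_eq_square mult_ac)
  qed (use low[OF y] in simp)
  have low3: "1 / (64 * C\<^sup>2) * norm y \<le> norm ((T o\<^sub>L T') y)" if "y \<in> V" for y
    using low2[OF that] C(1) by (simp add: field_simps)
  show 1: "\<exists>\<delta>>0. \<forall>y\<in>range T. \<delta> * norm y \<le> norm (T (T' y))"
    using low3 C(1) by (intro exI[of _ "1 / (64 * C\<^sup>2)"]) (auto simp: V_def)
  have onto: "(T o\<^sub>L T') ` V = V"
  proof (rule selfadjoint_surj_on)
    show "closed V" "subspace V" using cl sV by (auto simp: V_def)
    show "c *\<^sub>C x \<in> V" if "x \<in> V" for c x
      using that adjoint_pair_scaleC[OF adj] unfolding V_def by (metis rangeE rangeI)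
    show "selfadjoint (T o\<^sub>L T')"
      using adj adjoint_pair_selfadjoint adjoint_pair_compose adjoint_pair_sym by blast
    show "1 / (64 * C\<^sup>2) > 0" using C(1) by simp
  qed (use low3 in \<open>auto simp: V_def\<close>)
  show 2: "\<exists>v\<in>range T. T (T' v) = y" if "y \<in> range T" for y
    using onto that unfolding V_def by (metis blinfun_apply_blinfun_compose imageE)
  show 3: "\<exists>y. T' (x - T y) = 0" for x
  proof -
    obtain y where "T (T' (T y)) = T (T' x)" using 2[of "T (T' x)"] by blast
    then have "T (T' (x - T y)) = 0" by (simp add: blinfun.diff_right)
    then have "(norm (T' (x - T y)))\<^sup>2 \<le> 0" using norm_adjoint_le[OF adj, of "x - T y"] by simp
    then show ?thesis by auto
  qed
  have "range T' = T' ` V"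
  proof
    show "range T' \<subseteq> T' ` V"
    proof
      fix z assume "z \<in> range T'"
      then obtain x where "z = T' x" by blast
      moreover obtain y where "T' (x - T y) = 0" using 3 by blast
      ultimately have "z = T' (T y)" by (simp add: blinfun.diff_right)
      then show "z \<in> T' ` V" by (auto simp: V_def)
    qed
  qed auto
  moreover have "complete (T' ` V)"
  proof (rule complete_isometric_image)
    show "1 / (4 * C) > 0" using C(1) by simp
    show "\<forall>x\<in>V. 1 / (4 * C) * norm x \<le> norm (T' x)" using low C(1) by (simp add: field_simps)
    show "complete V" using cl by (simp add: V_def complete_eq_closed)
  qed (use sV in \<open>auto intro: blinfun.bounded_linear_right\<close>)
  ultimately show "closed (range T')" by (simp add: complete_eq_closed)
qed

subsection \<open>Orthogonal projections\<close>

abbreviation perp :: "'x set \<Rightarrow> 'x set"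
  where "perp \<equiv> orth ip"

abbreviation compl :: "'x set \<Rightarrow> bool"
  where "compl \<equiv> complemented act ip"

lemma perp_closed: "closed (perp S)"
proof -
  have "perp S = (\<Inter>y\<in>S. (\<lambda>x. ip x y) -` {0})" by (auto simp: orth_def)
  moreover have "closed ((\<lambda>x. ip x y) -` {0})" for y
    using continuous_closed_vimage[of "{0}" "\<lambda>x. ip x y"]
      linear_continuous_at[OF ip.bounded_linear_left] by blast
  ultimately show ?thesis by auto
qed

lemma perp_submodule: "submodule act (perp S)"
proof -
  have "ip (act x b) y = b\<^sup>\<star> * ip x y" for x y b
    by (metis ip_act_right ip_star star_mult)
  then show ?thesis
    by (auto simp: submodule_def orth_def ip.zero_left ip_add_left ip_scaleC_left)
qed

lemma submodule_subspace: "submodule act S \<Longrightarrow> subspace S"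
  unfolding submodule_def subspace_def by (metis scaleC_of_real)

lemma perp_subspace: "subspace (perp S)"
  by (rule submodule_subspace[OF perp_submodule])

lemma perpD: "x \<in> perp S \<Longrightarrow> y \<in> S \<Longrightarrow> ip x y = 0" "x \<in> perp S \<Longrightarrow> y \<in> S \<Longrightarrow> ip y x = 0"
  using ip_commute_0 by (auto simp: orth_def)

lemma perp_self: "x \<in> S \<Longrightarrow> x \<in> perp S \<Longrightarrow> x = 0"
  using perpD ip_self_eq_0 by blast

lemma compl_subspace: "compl S \<Longrightarrow> subspace S"
  using submodule_subspace by (auto simp: complemented_def)

lemma complI:
  assumes "submodule act S" "closed S" "\<And>x. \<exists>y\<in>S. x - y \<in> perp S"
  shows "compl S"
proof -
  have "x \<in> S + perp S" for x
    using assms(3)[of x] unfolding mem_set_plus_iff by (metis add.commute diff_add_cancel)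
  moreover have "S \<inter> perp S = {0}"
    using assms(1) perp_subspace[of S] perp_self by (auto simp: submodule_def subspace_0)
  ultimately show ?thesis using assms by (auto simp: complemented_def direct_sum_def)
qed

lemma proj_mem:
  assumes "compl S"
  shows "proj ip S x \<in> S" "x - proj ip S x \<in> perp S"
proof -
  have "x \<in> S + perp S" using assms by (auto simp: complemented_def direct_sum_def)
  then obtain y z where yz: "y \<in> S" "z \<in> perp S" "x = y + z" unfolding mem_set_plus_iff by blast
  have "proj ip S x \<in> S \<and> x - proj ip S x \<in> perp S"
    unfolding proj_def
  proof (rule theI)
    show "y \<in> S \<and> x - y \<in> perp S" using yz by simp
    fix w assume w: "w \<in> S \<and> x - w \<in> perp S"
    have "(x - y) - (x - w) \<in> perp S" using w yz perp_subspace subspace_diff by fastforce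
    moreover have "w - y \<in> S" using w yz compl_subspace[OF assms] subspace_diff by blast
    ultimately show "w = y" using perp_self[of "w - y" S] by simp
  qed
  then show "proj ip S x \<in> S" "x - proj ip S x \<in> perp S" by auto
qed

lemma proj_unique:
  assumes "compl S" "y \<in> S" "x - y \<in> perp S"
  shows "proj ip S x = y"
proof -
  have "(x - y) - (x - proj ip S x) \<in> perp S"
    using assms proj_mem perp_subspace subspace_diff by blast
  moreover have "proj ip S x - y \<in> S"
    using assms proj_mem compl_subspace subspace_diff by blast
  ultimately show ?thesis using perp_self[of "proj ip S x - y" S] by simp
qed

text \<open>The reflection \<open>2 P - 1\<close> preserves inner squares, which gives \<open>\<parallel>P\<parallel> \<le> 1\<close>.\<close>

lemma norm_proj_le:
  assumes "compl S"
  shows "norm (proj ip S x) \<le> norm x"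
proof -
  let ?y = "proj ip S x" and ?z = "x - proj ip S x"
  have "ip ?y ?z = 0" "ip ?z ?y = 0" using proj_mem[OF assms, of x] perpD by blast+
  then have "ip (?y - ?z) (?y - ?z) = ip (?y + ?z) (?y + ?z)"
    by (simp add: ip.diff_left ip.diff_right ip.add_left ip.add_right del: add_diff_cancel_left' add_diff_cancel_right' diff_add_cancel)
  then have "norm (?y - ?z) = norm (?y + ?z)" by (rule norm_eq_if_ip_eq)
  then have "norm (2 *\<^sub>R ?y) \<le> norm x + norm x"
    using norm_triangle_ineq[of "?y + ?z" "?y - ?z"] by (simp add: scaleR_2 algebra_simps)
  then show ?thesis by simp
qed

lemma bounded_linear_proj: "compl S \<Longrightarrow> bounded_linear (proj ip S)"
proof (rule bounded_linear_intro[of _ 1])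
  assume S: "compl S"
  note ss = compl_subspace[OF S] and ps = perp_subspace[of S]
  fix x y r
  show "proj ip S (x + y) = proj ip S x + proj ip S y"
  proof (rule proj_unique[OF S])
    show "proj ip S x + proj ip S y \<in> S" by (intro subspace_add ss proj_mem S)
    have "(x - proj ip S x) + (y - proj ip S y) \<in> perp S" by (intro subspace_add ps proj_mem S)
    then show "x + y - (proj ip S x + proj ip S y) \<in> perp S" by (simp add: algebra_simps)
  qed
  show "proj ip S (r *\<^sub>R x) = r *\<^sub>R proj ip S x"
  proof (rule proj_unique[OF S])
    show "r *\<^sub>R proj ip S x \<in> S" by (intro subspace_scale ss proj_mem S)
    have "r *\<^sub>R (x - proj ip S x) \<in> perp S" by (intro subspace_scale ps proj_mem S)
    then show "r *\<^sub>R x - r *\<^sub>R proj ip S x \<in> perp S" by (simp add: algebra_simps)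
  qed
  show "norm (proj ip S x) \<le> norm x * 1" using norm_proj_le[OF S] by simp
qed

definition Proj :: "'x set \<Rightarrow> 'x \<Rightarrow>\<^sub>L 'x"
  where "Proj S = Blinfun (proj ip S)"

lemma Proj_apply: "compl S \<Longrightarrow> blinfun_apply (Proj S) = proj ip S"
  by (simp add: Proj_def bounded_linear_Blinfun_apply bounded_linear_proj)

lemma Proj_mem: "compl S \<Longrightarrow> Proj S x \<in> S" "compl S \<Longrightarrow> x - Proj S x \<in> perp S"
  by (simp_all add: Proj_apply proj_mem)

lemma Proj_fix_iff: "compl S \<Longrightarrow> Proj S x = x \<longleftrightarrow> x \<in> S"
  using perp_subspace[of S] by (metis Proj_apply Proj_mem(1) proj_unique diff_self subspace_0)

lemma Proj_0_iff: "compl S \<Longrightarrow> Proj S x = 0 \<longleftrightarrow> x \<in> perp S"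
  using compl_subspace[of S]
  by (metis Proj_apply Proj_mem(2) proj_unique diff_zero subspace_0)

lemma norm_Proj_le: "compl S \<Longrightarrow> norm (Proj S x) \<le> norm x"
  by (simp add: Proj_apply norm_proj_le)

lemma Proj_idem: "compl S \<Longrightarrow> Proj S (Proj S x) = Proj S x"
  by (simp add: Proj_fix_iff Proj_mem)

lemma Proj_selfadjoint: "compl S \<Longrightarrow> selfadjoint (Proj S)"
  unfolding selfadjoint_def
proof (intro allI)
  fix x y assume S: "compl S"
  have "ip (Proj S x) (y - Proj S y) = 0" "ip (x - Proj S x) (Proj S y) = 0"
    using Proj_mem[OF S] perpD by blast+
  then show "ip (Proj S x) y = ip x (Proj S y)"
    by (simp add: ip.diff_left ip.diff_right)
qed

lemma perp_perp: "compl S \<Longrightarrow> perp (perp S) = S"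
proof (intro antisym subsetI)
  fix x assume S: "compl S" and x: "x \<in> perp (perp S)"
  have "Proj S x \<in> perp (perp S)"
    unfolding orth_def[of ip "perp S"] using perpD(2)[OF _ Proj_mem(1)[OF S]] by blast
  then have "x - Proj S x \<in> perp (perp S)" using x by (intro subspace_diff perp_subspace)
  then have "x - Proj S x = 0" by (rule perp_self[OF Proj_mem(2)[OF S]])
  then show "x \<in> S" using Proj_mem(1)[OF S, of x] by simp
qed (auto simp: orth_def ip_commute_0)

lemma compl_perp:
  assumes S: "compl S"
  shows "compl (perp S)" "Proj (perp S) x = x - Proj S x"
proof -
  have *: "x - Proj S x \<in> perp S" "x - (x - Proj S x) \<in> perp (perp S)" for x
    using Proj_mem[OF S] by (simp_all add: perp_perp[OF S])
  then show 1: "compl (perp S)"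
    by (intro complI perp_submodule perp_closed) blast
  show "Proj (perp S) x = x - Proj S x"
    using * by (simp add: Proj_apply[OF 1] proj_unique[OF 1])
qed

end

lemma norm_blinfun_compose3: "norm (f o\<^sub>L g o\<^sub>L h) \<le> norm f * norm g * norm h"
  by (rule order_trans[OF norm_blinfun_compose mult_right_mono[OF norm_blinfun_compose norm_ge_zero]])

context hilbert_module
begin

subsection \<open>Products of two projections\<close>

definition projection :: "('x \<Rightarrow>\<^sub>L 'x) \<Rightarrow> bool"
  where "projection p \<longleftrightarrow> selfadjoint p \<and> (\<forall>x. p (p x) = p x)"

lemma Proj_projection: "compl S \<Longrightarrow> projection (Proj S)"
  by (simp add: projection_def Proj_selfadjoint Proj_idem)

lemma projection_diff:
  assumes "projection p" "projection r" "\<And>x. p (r x) = r x" "\<And>x. r (p x) = r x"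
  shows "projection (p - r)"
  using assms by (auto simp: projection_def blinfun.bilinear_simps intro: selfadjoint_intros)

lemma projection_compl: "projection p \<Longrightarrow> projection (id_blinfun - p)"
  by (auto simp: projection_def blinfun.bilinear_simps intro: selfadjoint_intros)

lemma norm_projection_le: "projection p \<Longrightarrow> norm p \<le> 1"
  using norm_le_if_sum_squares[of p "id_blinfun - p" 1]
  by (auto simp: projection_def blinfun.bilinear_simps abs_square_le_1
      intro!: selfadjoint_intros commutes_intros)

lemma norm_reflection_le: "projection p \<Longrightarrow> norm (p - (id_blinfun - p)) \<le> 1"
  using norm_le_if_sum_squares[of "p - (id_blinfun - p)" 0 1]
  by (auto simp: projection_def blinfun.bilinear_simps abs_square_le_1
      intro!: selfadjoint_intros commutes_intros)

text \<open>The operator \<open>a\<close> is \<open>h p\<close> for the root \<open>h\<close> of the average \<open>(q + u q u) / 2\<close> over the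
  isometric reflection \<open>u = 2 p - 1\<close>. Unlike for \<open>p q p\<close> itself, it is immediate that this average
  differs from \<open>1\<close> by a contraction; it commutes with \<open>p\<close> and agrees with \<open>p q p\<close> on the range
  of \<open>p\<close>.\<close>

lemma projection_product_root:
  assumes p: "projection p" and q: "projection q"
  obtains a where "selfadjoint a" "\<And>x. a (a x) = p (q (p x))" "\<And>x. norm (q (p x)) = norm (a x)"
proof -
  have sp: "selfadjoint p" and pp: "p (p x) = p x" and sq: "selfadjoint q" and qq: "q (q x) = q x" for x
    using p q by (auto simp: projection_def)
  define u where "u = p - (id_blinfun - p)"
  have nu: "norm u \<le> 1" unfolding u_def by (rule norm_reflection_le[OF p])
  have su: "selfadjoint u" unfolding u_def by (intro selfadjoint_intros sp)
  define A where "A = (1 / 2) *\<^sub>R (q + (u o\<^sub>L q o\<^sub>L u))"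
  have sA: "selfadjoint A" unfolding A_def by (intro selfadjoint_intros sq su)
  \<comment> \<open>Because \<open>u\<close> squares to the identity, 1 - A is the same average with
    1 - q in place of \<open>q\<close>, a mean of two contractions.\<close>
  have "id_blinfun - A = (1 / 2) *\<^sub>R ((id_blinfun - q) + (u o\<^sub>L (id_blinfun - q) o\<^sub>L u))"
    by (rule blinfun_eqI)
      (simp add: A_def u_def blinfun.bilinear_simps pp algebra_simps scaleR_2[symmetric])
  moreover have "norm (u o\<^sub>L (id_blinfun - q) o\<^sub>L u) \<le> norm u * norm (id_blinfun - q) * norm u"
    by (rule norm_blinfun_compose3)
  moreover have "norm u * norm (id_blinfun - q) * norm u \<le> 1 * 1 * 1"
    using nu norm_projection_le[OF projection_compl[OF q]] by (intro mult_mono) auto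
  ultimately have "norm (id_blinfun - A) \<le> 1"
    using norm_triangle_ineq[of "id_blinfun - q" "u o\<^sub>L (id_blinfun - q) o\<^sub>L u"]
      norm_projection_le[OF projection_compl[OF q]] by simp
  then obtain h where h: "selfadjoint h" "\<And>x. h (h x) = A x" "\<And>B. commutes B A \<Longrightarrow> commutes B h"
    using selfadjoint_root[OF sA] by metis
  have Ap: "A (p x) = p (q (p x))" "p (A x) = p (q (p x))" for x
    by (simp_all add: A_def u_def blinfun.bilinear_simps pp scaleR_2[symmetric] scaleR_diff_right)
  have ph: "p (h x) = h (p x)" for x
    using h(3)[of p] Ap by (simp add: commutes_def)
  show thesis
  proof
    show "selfadjoint (h o\<^sub>L p)"
      by (intro selfadjoint_intros h sp) (simp add: commutes_def ph)
    show "(h o\<^sub>L p) ((h o\<^sub>L p) x) = p (q (p x))" for x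
      by (simp add: ph pp h(2) Ap)
    show "norm (q (p x)) = norm ((h o\<^sub>L p) x)" for x
    proof (rule norm_eq_if_ip_eq)
      have "ip (q (p x)) (q (p x)) = ip x (p (q (p x)))"
        by (simp add: selfadjointD[OF sq] selfadjointD[OF sp] qq)
      also have "\<dots> = ip ((h o\<^sub>L p) x) ((h o\<^sub>L p) x)"
        by (simp add: selfadjointD[OF h(1)] selfadjointD[OF sp] h(2) Ap pp)
      finally show "ip (q (p x)) (q (p x)) = ip ((h o\<^sub>L p) x) ((h o\<^sub>L p) x)" .
    qed
  qed
qed

text \<open>With the root \<open>a\<close> of p q p, the square of the norm of q p is at most that
  of \<open>a\<close>, hence at most the norm of (p q)(q p); one factor cancels. The detour through
  \<open>a\<close> avoids the factor 4 in the bound for adjoints.\<close>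

lemma norm_projection_product_le:
  assumes "projection p" "projection q"
  shows "norm (q o\<^sub>L p) \<le> norm (p o\<^sub>L q)"
proof -
  have qq: "q (q x) = q x" for x using assms by (simp add: projection_def)
  obtain a where a: "selfadjoint a" "\<And>x. a (a x) = p (q (p x))" "\<And>x. norm (q (p x)) = norm (a x)"
    using projection_product_root[OF assms] by blast
  have "norm (q o\<^sub>L p) \<le> norm a"
    by (rule norm_blinfun_bound) (simp_all add: a(3) norm_blinfun)
  then have "(norm (q o\<^sub>L p))\<^sup>2 \<le> (norm a)\<^sup>2" by (intro power_mono) auto
  also have "\<dots> \<le> norm (a o\<^sub>L a)" by (rule norm_selfadjoint_square[OF a(1)])
  also have "a o\<^sub>L a = (p o\<^sub>L q) o\<^sub>L (q o\<^sub>L p)" by (rule blinfun_eqI) (simp add: a(2) qq)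
  also have "norm \<dots> \<le> norm (p o\<^sub>L q) * norm (q o\<^sub>L p)" by (rule norm_blinfun_compose)
  finally show ?thesis 
    by (cases "q o\<^sub>L p = 0") (simp_all add: power2_eq_square)
qed

lemma norm_projection_product_commute:
  "projection p \<Longrightarrow> projection q \<Longrightarrow> norm (p o\<^sub>L q) = norm (q o\<^sub>L p)"
  by (intro antisym norm_projection_product_le)

text \<open>The closed range theorem, with \<open>T\<close> as its own adjoint, bounds T^2 below and
  therefore \<open>T\<close>. So the set-theoretic inverse is unique and bounded.\<close>

lemma selfadjoint_surj_inverse:
  assumes T: "selfadjoint T" and surj: "range T = UNIV"
  obtains Y where "selfadjoint Y" "\<And>x. T (Y x) = x" "\<And>B. commutes B T \<Longrightarrow> commutes B Y"
proof -
  have "adjoint_pair T T" using T by (simp add: adjoint_pair_selfadjoint)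
  moreover have "closed (range T)" unfolding surj by simp
  ultimately have "\<exists>\<delta>>0. \<forall>y\<in>range T. \<delta> * norm y \<le> norm (T (T y))"
    by (rule adjoint_closed_range)
  then obtain \<delta> where \<delta>: "\<delta> > 0" "\<And>y. \<delta> * norm y \<le> norm (T (T y))"
    unfolding surj by blast
  define K where "K = norm T / \<delta>"
  have low: "norm y \<le> K * norm (T y)" for y
    using \<delta>(2)[of y] norm_blinfun[of T "T y"] \<delta>(1) unfolding K_def by (simp add: field_simps)
  have inj: "x = y" if "T x = T y" for x y
    using low[of "x - y"] that by (simp add: blinfun.diff_right)
  define g where "g = inv T"
  have g: "T (g x) = x" for x unfolding g_def by (rule surj_f_inv_f[OF surj])
  have "bounded_linear g"
  proof (rule bounded_linear_intro[of _ K])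
    show "g (x + y) = g x + g y" "g (r *\<^sub>R x) = r *\<^sub>R g x" for x y r
      by (rule inj, simp add: g blinfun.bilinear_simps)+
    show "norm (g x) \<le> norm x * K" for x using low[of "g x"] by (simp add: g mult.commute)
  qed
  then have Y: "blinfun_apply (Blinfun g) = g" by (rule bounded_linear_Blinfun_apply)
  show thesis
  proof
    show "selfadjoint (Blinfun g)"
      unfolding selfadjoint_def Y
    proof (intro allI)
      fix x y
      show "ip (g x) y = ip x (g y)" using selfadjointD[OF T, of "g x" "g y"] by (simp add: g)
    qed
    show "T (Blinfun g x) = x" for x by (simp add: Y g)
    show "commutes B (Blinfun g)" if "commutes B T" for B
      unfolding commutes_def Y
    proof
      fix x
      show "B (g x) = g (B x)"
        by (rule inj) (simp add: g flip: commutesD[OF that])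
    qed
  qed
qed

text \<open>With \<open>c\<close> above the norm of the inverse of \<open>1 - p q p\<close>, the operator
  \<open>1 - p q p - 1/c\<close> is a square, so that \<open>p q p\<close> plus a square equals \<open>1 - 1/c\<close>.\<close>

lemma norm_projection_product_less:
  assumes p: "projection p" and q: "projection q" and surj: "range (\<lambda>x. x - p (q (p x))) = UNIV"
  shows "norm (q o\<^sub>L p) < 1"
proof -
  obtain a where a: "selfadjoint a" "\<And>x. a (a x) = p (q (p x))" "\<And>x. norm (q (p x)) = norm (a x)"
    using projection_product_root[OF p q] by blast
  define A where "A = a o\<^sub>L a"
  have A: "A x = p (q (p x))" for x by (simp add: A_def a)
  have "A = p o\<^sub>L q o\<^sub>L p" by (rule blinfun_eqI) (simp add: A)
  then have "norm A \<le> norm p * norm q * norm p"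
    by (simp add: norm_blinfun_compose3)
  also have "\<dots> \<le> 1 * 1 * 1" using norm_projection_le[OF p] norm_projection_le[OF q] by (intro mult_mono) auto
  finally have nA: "norm A \<le> 1" by simp
  define T where "T = id_blinfun - A"
  have T: "selfadjoint T" unfolding T_def A_def by (intro selfadjoint_intros commutes_intros a)
  have "range T = UNIV" using surj by (simp add: T_def blinfun.bilinear_simps A)
  with T obtain Y where Y: "selfadjoint Y" "\<And>x. T (Y x) = x" "\<And>B. commutes B T \<Longrightarrow> commutes B Y"
    by (rule selfadjoint_surj_inverse) blast
  \<comment> \<open>The summand 1 ensures \<open>c \<ge> 1\<close>, so that 1 - 1/c is nonnegative
    and below 1; it also makes Y / c a contraction, so that \<open>Z\<close> has a root.\<close>
  define c where "c = norm Y + 1"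
  have c: "c \<ge> 1" by (simp add: c_def)
  have "norm (id_blinfun - T) \<le> 1" using nA by (simp add: T_def)
  then obtain d where d: "selfadjoint d" "\<And>x. d (d x) = T x" "\<And>B. commutes B T \<Longrightarrow> commutes B d"
    using selfadjoint_root[OF T] by metis
  define Z where "Z = id_blinfun - (1 / c) *\<^sub>R Y"
  have Z: "selfadjoint Z" unfolding Z_def by (intro selfadjoint_intros Y)
  have "norm Y \<le> c" by (simp add: c_def)
  then have "norm (id_blinfun - Z) \<le> 1" using c by (simp add: Z_def divide_le_eq)
  then obtain w where w: "selfadjoint w" "\<And>x. w (w x) = Z x" "\<And>B. commutes B Z \<Longrightarrow> commutes B w"
    using selfadjoint_root[OF Z] by metis
  have cw: "commutes B w" if "commutes B T" for B
    using that by (intro w(3)) (auto simp: Z_def intro!: commutes_intros Y)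
  have cdT: "commutes d T" using d(3)[of T] by (intro commutes_sym[OF d(3)] commutes_intros)
  have aT: "commutes a T" unfolding T_def A_def by (intro commutes_intros)
  have dw: "commutes d w" by (rule cw[OF cdT])
  \<comment> \<open>The square is that of d w: as d^2 = T and w^2 = 1 - Y / c commute, it equals T -
    1/c.\<close>
  have "(norm a)\<^sup>2 \<le> \<bar>1 - 1 / c\<bar>"
  proof (rule norm_le_if_sum_squares)
    show "selfadjoint (d o\<^sub>L w)" by (intro selfadjoint_intros d w dw)
    show "commutes a (d o\<^sub>L w)" by (intro commutes_intros d(3) cw aT)
    show "a (a x) + (d o\<^sub>L w) ((d o\<^sub>L w) x) = (1 - 1 / c) *\<^sub>R x" for x
    proof -
      have "(d o\<^sub>L w) ((d o\<^sub>L w) x) = d (d (w (w x)))" by (simp add: commutesD[OF dw])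
      also have "\<dots> = T x - (1 / c) *\<^sub>R x"
        by (simp add: d(2) w(2)) (simp add: Z_def blinfun.bilinear_simps Y(2))
      also have "T x = x - a (a x)" by (simp add: T_def blinfun.bilinear_simps A_def)
      finally show ?thesis by (simp add: scaleR_diff_left)
    qed
  qed (rule a)
  moreover have "\<bar>1 - 1 / c\<bar> < 1" using c by (simp add: abs_if)
  ultimately have "(norm a)\<^sup>2 < 1" by linarith
  then have "norm a < 1" by (simp add: abs_square_less_1)
  moreover have "norm (q o\<^sub>L p) \<le> norm a"
    by (rule norm_blinfun_bound) (simp_all add: a(3) norm_blinfun)
  ultimately show ?thesis by simp
qed

subsection \<open>Sums and intersections\<close>

lemma subspace_set_plus: "subspace U \<Longrightarrow> subspace V \<Longrightarrow> subspace (U + V)" for U V :: "'x set"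
  using subspace_sums[of U V] by (simp add: set_plus_def Bex_def) (smt (verit) Collect_cong)

lemma mem_set_plus_left: "x \<in> U \<Longrightarrow> 0 \<in> V \<Longrightarrow> x \<in> U + V" for U V :: "'x set"
  by (metis add.right_neutral set_plus_intro)

lemma perp_Int_superset: "perp M + perp N \<subseteq> perp (M \<inter> N)"
  by (auto simp: set_plus_def orth_def ip_add_left)

text \<open>Projecting a vector of \<open>perp N\<close> onto \<open>M\<close> changes it by an
  element of \<open>perp M\<close>. This turns closedness of a sum of subspaces into closedness of
  the range of an adjointable operator.\<close>

lemma range_Proj_Proj_perp:
  assumes M: "compl M" and N: "compl N"
  shows "range (Proj M o\<^sub>L Proj (perp N)) = M \<inter> (perp M + perp N)"
proof (intro antisym subsetI)
  fix z assume "z \<in> range (Proj M o\<^sub>L Proj (perp N))"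
  then obtain u where u: "z = Proj M (Proj (perp N) u)" by auto
  let ?w = "Proj (perp N) u"
  have "- (?w - Proj M ?w) \<in> perp M" by (intro subspace_neg perp_subspace Proj_mem M)
  moreover have "?w \<in> perp N" by (intro Proj_mem compl_perp N)
  ultimately have "- (?w - Proj M ?w) + ?w \<in> perp M + perp N" by (rule set_plus_intro)
  then show "z \<in> M \<inter> (perp M + perp N)" using u Proj_mem(1)[OF M] by simp
next
  fix z assume "z \<in> M \<inter> (perp M + perp N)"
  then obtain a b where ab: "z \<in> M" "a \<in> perp M" "b \<in> perp N" "z = a + b" by (auto simp: mem_set_plus_iff)
  have "z = Proj M z" using ab(1) Proj_fix_iff[OF M] by metis
  also have "\<dots> = Proj M b" using ab Proj_0_iff[OF M] by (simp add: blinfun.add_right)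
  also have "\<dots> = Proj M (Proj (perp N) b)" using ab Proj_fix_iff[OF compl_perp(1)[OF N]] by metis
  finally show "z \<in> range (Proj M o\<^sub>L Proj (perp N))" by auto
qed

lemma adjoint_pair_Proj_Proj:
  "compl M \<Longrightarrow> compl N \<Longrightarrow> adjoint_pair (Proj M o\<^sub>L Proj N) (Proj N o\<^sub>L Proj M)"
  by (intro adjoint_pair_compose) (simp_all add: Proj_selfadjoint flip: adjoint_pair_selfadjoint)

lemma closed_range_Proj_Proj_perp:
  assumes "compl M" "compl N" "closed (perp M + perp N)"
  shows "closed (range (Proj M o\<^sub>L Proj (perp N)))"
  using assms by (simp add: range_Proj_Proj_perp closed_Int complemented_def del: blinfun_apply_blinfun_compose)

lemma direct_sum_IntI:
  assumes "\<And>x. \<exists>y\<in>M \<inter> N. x - y \<in> perp M + perp N" "0 \<in> M \<inter> N"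
  shows "direct_sum (M \<inter> N) (perp M + perp N)"
proof -
  have "x \<in> (M \<inter> N) + (perp M + perp N)" for x
    using assms(1)[of x] unfolding mem_set_plus_iff[of x] by (metis add.commute diff_add_cancel)
  moreover have "x = 0" if "x \<in> M \<inter> N" "x \<in> perp M + perp N" for x
    using that perp_Int_superset perp_self by blast
  moreover have "0 \<in> perp M + perp N"
    by (intro subspace_0 subspace_set_plus perp_subspace)
  ultimately show ?thesis using assms(2) unfolding direct_sum_def by blast
qed

lemma zero_mem_Int: "compl M \<Longrightarrow> compl N \<Longrightarrow> 0 \<in> M \<inter> N"
  using compl_subspace subspace_0 by blast

text \<open>\<open>X\<close> is the range of \<open>?S\<close> plus the kernel of
  \<open>?S'\<close>. The range lies in \<open>perp M + perp N\<close>. For \<open>?v\<close> in the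
  kernel, \<open>Proj M ?v\<close> lies in both \<open>M\<close> and \<open>N\<close>, and the rest
  of \<open>?v\<close> in \<open>perp M\<close>.\<close>

lemma closed_sum_imp_direct_sum:
  assumes M: "compl M" and N: "compl N" and cl: "closed (perp M + perp N)"
  shows "direct_sum (M \<inter> N) (perp M + perp N)"
proof (rule direct_sum_IntI[OF _ zero_mem_Int[OF M N]])
  fix x
  let ?S = "Proj M o\<^sub>L Proj (perp N)" and ?S' = "Proj (perp N) o\<^sub>L Proj M"
  have "adjoint_pair ?S ?S'" by (intro adjoint_pair_Proj_Proj compl_perp M N)
  then obtain y where y: "?S' (x - ?S y) = 0"
    using adjoint_closed_range(3)[OF _ closed_range_Proj_Proj_perp[OF M N cl]] by blast
  let ?v = "x - ?S y"
  have "Proj M ?v \<in> perp (perp N)"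
    using y Proj_0_iff[OF compl_perp(1)[OF N]] by simp
  then have 1: "Proj M ?v \<in> M \<inter> N" using perp_perp[OF N] Proj_mem(1)[OF M] by blast
  have "?S y \<in> perp M + perp N" using range_Proj_Proj_perp[OF M N] by blast
  moreover have "?v - Proj M ?v \<in> perp M + perp N"
    by (intro mem_set_plus_left Proj_mem M subspace_0 perp_subspace)
  ultimately have "?S y + (?v - Proj M ?v) \<in> perp M + perp N"
    by (intro subspace_add subspace_set_plus perp_subspace)
  then have "x - Proj M ?v \<in> perp M + perp N" by (simp add: algebra_simps del: blinfun_apply_blinfun_compose)
  with 1 show "\<exists>y\<in>M \<inter> N. x - y \<in> perp M + perp N" by blast
qed

lemma submodule_Int: "compl M \<Longrightarrow> compl N \<Longrightarrow> submodule act (M \<inter> N) \<and> closed (M \<inter> N)"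
  by (auto simp: complemented_def submodule_def)

lemma direct_sum_imp_perp_Int:
  assumes M: "compl M" and N: "compl N" and ds: "direct_sum (M \<inter> N) (perp M + perp N)"
  shows "perp (M \<inter> N) = perp M + perp N" "compl (M \<inter> N)"
proof -
  show *: "perp (M \<inter> N) = perp M + perp N"
  proof (intro antisym perp_Int_superset subsetI)
    fix x assume x: "x \<in> perp (M \<inter> N)"
    have "x \<in> (M \<inter> N) + (perp M + perp N)" using ds by (simp add: direct_sum_def)
    then obtain u v where uv: "u \<in> M \<inter> N" "v \<in> perp M + perp N" "x = u + v"
      unfolding mem_set_plus_iff[of x] by blast
    then have "x - v \<in> perp (M \<inter> N)"
      using x perp_Int_superset by (intro subspace_diff perp_subspace) auto
    then have "u = 0" using uv perp_self[of u "M \<inter> N"] by simp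
    then show "x \<in> perp M + perp N" using uv by simp
  qed
  show "compl (M \<inter> N)"
    using submodule_Int[OF M N] ds * by (simp add: complemented_def)
qed

lemma direct_sum_iff_closed:
  assumes M: "compl M" and N: "compl N"
  shows "direct_sum (M \<inter> N) (perp M + perp N) \<longleftrightarrow> closed (perp M + perp N)"
  using closed_sum_imp_direct_sum[OF assms] direct_sum_imp_perp_Int(1)[OF assms] perp_closed by metis

text \<open>Closedness of the range passes to the adjoint \<open>?S'\<close>, whose range is the
  part of \<open>N + M\<close> in \<open>perp N\<close>. As \<open>N\<close> is contained in the
  sum, \<open>M + N\<close> is the preimage of that part under \<open>Proj (perp N)\<close>.\<close>

lemma closed_perp_sum_imp_closed_sum:
  assumes M: "compl M" and N: "compl N" and cl: "closed (perp M + perp N)"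
  shows "closed (M + N)"
proof -
  let ?S' = "Proj (perp N) o\<^sub>L Proj M"
  have pN: "compl (perp N)" and pM: "compl (perp M)" by (intro compl_perp M N)+
  have r: "range ?S' = perp N \<inter> (N + M)"
    using range_Proj_Proj_perp[OF pN pM] by (simp only: perp_perp M N)
  have "adjoint_pair (Proj M o\<^sub>L Proj (perp N)) ?S'" by (intro adjoint_pair_Proj_Proj M pN)
  then have clS: "closed (range ?S')"
    using adjoint_closed_range(4) closed_range_Proj_Proj_perp[OF M N cl] by blast
  have sub: "subspace (N + M)" by (intro subspace_set_plus compl_subspace M N)
  have "M + N = Proj (perp N) -` range ?S'"
  proof (intro antisym subsetI)
    fix x assume "x \<in> M + N"
    then obtain m n where mn: "m \<in> M" "n \<in> N" "x = m + n" by (auto simp: mem_set_plus_iff)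
    have "Proj (perp N) n = 0" using mn(2) by (simp add: Proj_0_iff pN perp_perp N)
    moreover have "Proj M m = m" using mn(1) by (simp add: Proj_fix_iff M)
    ultimately have "Proj (perp N) x = ?S' m" by (simp add: mn blinfun.add_right)
    then show "x \<in> Proj (perp N) -` range ?S'" by blast
  next
    fix x assume "x \<in> Proj (perp N) -` range ?S'"
    then have "Proj (perp N) x \<in> N + M" using r by blast
    moreover have "x - Proj (perp N) x \<in> N + M"
    proof (rule mem_set_plus_left)
      show "x - Proj (perp N) x \<in> N" using Proj_mem(1)[OF N, of x] by (simp add: compl_perp N)
      show "0 \<in> M" using compl_subspace[OF M] by (rule subspace_0)
    qed
    ultimately have "Proj (perp N) x + (x - Proj (perp N) x) \<in> N + M" using sub by (intro subspace_add)
    then show "x \<in> M + N" by (simp add: add.commute)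
  qed
  moreover have "closed (Proj (perp N) -` range ?S')"
    by (intro continuous_closed_vimage clS linear_continuous_at blinfun.bounded_linear_right)
  ultimately show ?thesis by simp
qed

lemma closed_perp_sum_iff_closed_sum:
  assumes M: "compl M" and N: "compl N"
  shows "closed (perp M + perp N) \<longleftrightarrow> closed (M + N)"
  using closed_perp_sum_imp_closed_sum[OF assms]
    closed_perp_sum_imp_closed_sum[OF compl_perp(1)[OF M] compl_perp(1)[OF N]]
  unfolding perp_perp[OF M] perp_perp[OF N] by blast

lemma Proj_Proj_subset:
  assumes S: "compl S" and T: "compl T" and "S \<subseteq> T"
  shows "Proj T (Proj S x) = Proj S x" "Proj S (Proj T x) = Proj S x"
proof -
  show "Proj T (Proj S x) = Proj S x" using Proj_mem(1)[OF S] assms(3) by (auto simp: Proj_fix_iff T)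
  have "x - Proj T x \<in> perp S" using Proj_mem(2)[OF T, of x] assms(3) by (auto simp: orth_def)
  then have "Proj S (x - Proj T x) = 0" by (simp add: Proj_0_iff S)
  then show "Proj S (Proj T x) = Proj S x" by (simp add: blinfun.diff_right)
qed

text \<open>The component in \<open>M \<inter> N\<close> can be subtracted within each summand.
  Hence the reduced sum is the part of \<open>M + N\<close> orthogonal to
  \<open>M \<inter> N\<close>, and \<open>M + N\<close> is its preimage under 1 - R; each
  description gives one implication.\<close>

lemma closed_sum_iff_closed_reduced_sum:
  assumes M: "compl M" and N: "compl N" and MN: "compl (M \<inter> N)"
  shows "closed (M + N) \<longleftrightarrow> closed ((perp (M \<inter> N) \<inter> M) + (perp (M \<inter> N) \<inter> N))"
proof -
  let ?L = "perp (M \<inter> N)" and ?R = "Proj (M \<inter> N)"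
  note sM = compl_subspace[OF M] and sN = compl_subspace[OF N]
  have reduce: "x - ?R x \<in> (?L \<inter> M) + (?L \<inter> N)" if x: "x \<in> M + N" for x
  proof -
    obtain m n where mn: "m \<in> M" "n \<in> N" "x = m + n" using x by (auto simp: mem_set_plus_iff)
    have "m - ?R m \<in> ?L \<inter> M" "n - ?R n \<in> ?L \<inter> N"
      using Proj_mem[OF MN, of m] Proj_mem[OF MN, of n] mn sM sN by (auto intro: subspace_diff)
    then have "(m - ?R m) + (n - ?R n) \<in> (?L \<inter> M) + (?L \<inter> N)" by (rule set_plus_intro)
    then show ?thesis by (simp add: mn blinfun.add_right algebra_simps)
  qed
  have "(?L \<inter> M) + (?L \<inter> N) = ?L \<inter> (M + N)"
  proof (intro antisym subsetI)
    fix x assume "x \<in> ?L \<inter> (M + N)"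
    then show "x \<in> (?L \<inter> M) + (?L \<inter> N)" using reduce[of x] Proj_0_iff[OF MN, of x] by simp
  next
    fix x assume "x \<in> (?L \<inter> M) + (?L \<inter> N)"
    then obtain m n where "m \<in> ?L \<inter> M" "n \<in> ?L \<inter> N" "x = m + n" by (auto simp: mem_set_plus_iff)
    then show "x \<in> ?L \<inter> (M + N)" by (auto intro: set_plus_intro subspace_add[OF perp_subspace])
  qed
  moreover have "M + N = (id_blinfun - ?R) -` ((?L \<inter> M) + (?L \<inter> N))"
  proof (intro antisym subsetI)
    fix x assume "x \<in> M + N"
    then show "x \<in> (id_blinfun - ?R) -` ((?L \<inter> M) + (?L \<inter> N))"
      using reduce by (simp add: blinfun.diff_left)
  next
    fix x assume "x \<in> (id_blinfun - ?R) -` ((?L \<inter> M) + (?L \<inter> N))"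
    then have "x - ?R x \<in> M + N" using set_plus_mono2[of "?L \<inter> M" M "?L \<inter> N" N] by (auto simp: blinfun.diff_left)
    moreover have "?R x \<in> M + N"
      using Proj_mem(1)[OF MN, of x] by (intro mem_set_plus_left subspace_0 sN) auto
    ultimately have "(x - ?R x) + ?R x \<in> M + N" by (intro subspace_add subspace_set_plus sM sN)
    then show "x \<in> M + N" by simp
  qed
  moreover have "closed ((id_blinfun - ?R) -` V)" if "closed V" for V
    using that by (intro continuous_closed_vimage linear_continuous_at blinfun.bounded_linear_right)
  ultimately show ?thesis using closed_Int[OF perp_closed] by metis
qed

end

section \<open>The conditions on norms, powers, bijectivity and ranges\<close>

lemma norm_blinfun_eq_onorm: "blinfun_apply T = f \<Longrightarrow> norm T = onorm f"
  by (simp add: norm_blinfun.rep_eq)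

context hilbert_module
begin

lemma ip_projection: "projection p \<Longrightarrow> ip (p x) (p x) = ip x (p x)"
  by (simp add: projection_def selfadjointD)

text \<open>The inner squares are compared in the algebra. Equal norms would not do: in a Hilbert
  module the squared norm is not additive over orthogonal vectors.\<close>

lemma projection_fix_if_ip_eq:
  assumes "projection p" "ip (p x) (p x) = ip x x"
  shows "p x = x"
proof -
  have "ip x (p x) = ip x x" using assms ip_projection by simp
  moreover have "ip (p x) x = ip x (p x)" using assms(1) by (simp add: projection_def selfadjointD)
  ultimately have "ip (x - p x) (x - p x) = 0"
    using assms(2) by (simp add: ip.diff_left ip.diff_right)
  then show ?thesis by simp
qed

lemma Proj_Proj_fix:
  assumes M: "compl M" and N: "compl N" and fp: "Proj M (Proj N y) = y"
  shows "y \<in> M \<inter> N"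
proof -
  have yM: "y \<in> M" using fp Proj_mem(1)[OF M] by metis
  have "ip (Proj N y) (Proj N y) = ip y (Proj N y)" by (rule ip_projection[OF Proj_projection[OF N]])
  also have "\<dots> = ip (Proj M y) (Proj N y)" using yM by (simp add: Proj_fix_iff[OF M, THEN iffD2])
  also have "\<dots> = ip y y" using selfadjointD[OF Proj_selfadjoint[OF M]] fp by simp
  finally have "Proj N y = y" by (rule projection_fix_if_ip_eq[OF Proj_projection[OF N]])
  then show ?thesis using yM Proj_fix_iff[OF N] by blast
qed

lemma diff_Proj_Proj_mem:
  assumes M: "compl M" and N: "compl N"
  shows "x - Proj M (Proj N x) \<in> perp M + perp N"
proof -
  have "(Proj N x - Proj M (Proj N x)) + (x - Proj N x) \<in> perp M + perp N"
    by (intro set_plus_intro Proj_mem M N)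
  then show ?thesis by simp
qed

text \<open>The results on products of two projections thus apply to P Q - R, which is itself such a
  product.\<close>

lemma reduced_projections:
  assumes M: "compl M" and N: "compl N" and MN: "compl (M \<inter> N)"
  defines "R \<equiv> Proj (M \<inter> N)"
  shows "projection (Proj M - R)" "projection (Proj N - R)"
    "(Proj M - R) o\<^sub>L (Proj N - R) = (Proj M o\<^sub>L Proj N) - R"
    "(Proj N - R) o\<^sub>L (Proj M - R) = (Proj N o\<^sub>L Proj M) - R"
proof -
  have abs: "Proj M (R x) = R x" "R (Proj M x) = R x" "Proj N (R x) = R x" "R (Proj N x) = R x" "R (R x) = R x" for x
    by (simp_all add: R_def Proj_Proj_subset MN M N Proj_idem)
  show "projection (Proj M - R)" "projection (Proj N - R)"
    using abs M N MN by (auto simp: R_def intro!: projection_diff Proj_projection)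
  show "(Proj M - R) o\<^sub>L (Proj N - R) = (Proj M o\<^sub>L Proj N) - R"
    "(Proj N - R) o\<^sub>L (Proj M - R) = (Proj N o\<^sub>L Proj M) - R"
    by (rule blinfun_eqI, simp add: blinfun.bilinear_simps abs)+
qed

lemma norm_Proj_Proj_diff_commute:
  assumes "compl M" "compl N" "compl (M \<inter> N)"
  shows "norm ((Proj M o\<^sub>L Proj N) - Proj (M \<inter> N)) = norm ((Proj N o\<^sub>L Proj M) - Proj (M \<inter> N))"
  using norm_projection_product_commute[OF reduced_projections(1,2)[OF assms]]
  by (simp add: reduced_projections(3,4)[OF assms])

text \<open>It suffices that 1 - p q p is onto for the reduced projections. It is the identity on
  \<open>M \<inter> N\<close> and on \<open>perp M\<close>, and on the range of \<open>?S\<close> it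
  agrees with S S', which maps that range onto itself. A vector of \<open>perp N\<close> splits into
  its projection to \<open>M\<close>, lying in that range, and a vector of
  \<open>perp M\<close>.\<close>

lemma direct_sum_imp_norm_less:
  assumes M: "compl M" and N: "compl N" and ds: "direct_sum (M \<inter> N) (perp M + perp N)"
  shows "norm ((Proj M o\<^sub>L Proj N) - Proj (M \<inter> N)) < 1"
proof -
  have MN: "compl (M \<inter> N)" and L: "perp (M \<inter> N) = perp M + perp N"
    using direct_sum_imp_perp_Int[OF assms] by auto
  define R where "R = Proj (M \<inter> N)"
  have abs: "Proj M (R x) = R x" "R (Proj M x) = R x" "Proj N (R x) = R x" "R (Proj N x) = R x" "R (R x) = R x" for x
    by (simp_all add: R_def Proj_Proj_subset MN M N Proj_idem)
  define p where "p = Proj M - R"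
  define q where "q = Proj N - R"
  let ?S = "Proj M o\<^sub>L Proj (perp N)" and ?S' = "Proj (perp N) o\<^sub>L Proj M"
  have "closed (perp M + perp N)" unfolding L[symmetric] by (rule perp_closed)
  then have clS: "closed (range ?S)" by (rule closed_range_Proj_Proj_perp[OF M N])
  have adj: "adjoint_pair ?S ?S'" by (intro adjoint_pair_Proj_Proj compl_perp M N)
  define T where "T = id_blinfun - (p o\<^sub>L q o\<^sub>L p)"
  have T: "T x = x - Proj M (Proj N (Proj M x)) + R x" for x
    by (simp add: T_def p_def q_def blinfun.bilinear_simps abs)
  have sT: "subspace (range T)" by (rule subspace_range_blinfun)
  have TM: "x \<in> range T" if "x \<in> perp M" for x
  proof -
    have "Proj M x = 0" using that by (simp add: Proj_0_iff M)
    moreover from this have "R x = 0" using abs(2)[of x] by (simp add: blinfun.zero_right)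
    ultimately have "T x = x" by (simp add: T blinfun.zero_right)
    then show ?thesis by (metis rangeI)
  qed
  have TN: "x \<in> range T" if x: "x \<in> perp N" for x
  proof -
    have "Proj (perp N) x = x" using x Proj_fix_iff[OF compl_perp(1)[OF N]] by blast
    then have Sx: "?S x = Proj M x" by simp
    obtain v where v: "v \<in> range ?S" "?S (?S' v) = ?S x"
      using adjoint_closed_range(2)[OF adj clS rangeI] by blast
    have vM: "v \<in> M" and vL: "v \<in> perp (M \<inter> N)"
      using v(1) unfolding range_Proj_Proj_perp[OF M N] L by auto
    have "Proj M v = v" "R v = 0" using vM vL by (simp_all add: R_def Proj_fix_iff Proj_0_iff M MN)
    then have "T v = ?S (?S' v)"
      by (simp add: T compl_perp(2)[OF N] blinfun.diff_right Proj_idem N)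
    then have "Proj M x \<in> range T" using v Sx by (metis rangeI)
    moreover have "x - Proj M x \<in> range T" by (intro TM Proj_mem M)
    ultimately have "Proj M x + (x - Proj M x) \<in> range T" by (rule subspace_add[OF sT])
    then show ?thesis by simp
  qed
  have "x \<in> range T" for x
  proof -
    have "x \<in> (M \<inter> N) + (perp M + perp N)" using ds by (simp add: direct_sum_def)
    then obtain u a b where x: "x = u + (a + b)" "u \<in> M \<inter> N" "a \<in> perp M" "b \<in> perp N"
      by (auto simp: mem_set_plus_iff)
    have "T u = u" using x(2) by (simp add: T R_def Proj_fix_iff[THEN iffD2] M N MN)
    then have "u \<in> range T" by (metis rangeI)
    then show ?thesis unfolding x(1) by (intro subspace_add sT TM[OF x(3)] TN[OF x(4)])
  qed
  then have "range (\<lambda>x. x - p (q (p x))) = UNIV"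
    by (simp add: T_def blinfun.diff_left set_eq_iff)
  then have "norm (q o\<^sub>L p) < 1"
    using reduced_projections(1,2)[OF M N MN]
    by (intro norm_projection_product_less) (simp_all add: p_def q_def R_def)
  then show ?thesis
    using reduced_projections(4)[OF M N MN] norm_Proj_Proj_diff_commute[OF M N MN]
    by (simp add: p_def q_def R_def)
qed

lemma funpow_Proj_Proj:
  assumes M: "compl M" and N: "compl N" and MN: "compl (M \<inter> N)"
  defines "D \<equiv> (Proj M o\<^sub>L Proj N) - Proj (M \<inter> N)"
  shows "norm (((Proj M \<circ> Proj N) ^^ n) x - Proj (M \<inter> N) x) \<le> norm D ^ n * norm x"
proof -
  define R where "R = Proj (M \<inter> N)"
  have abs: "Proj M (R x) = R x" "R (Proj M x) = R x" "Proj N (R x) = R x" "R (Proj N x) = R x" "R (R x) = R x" for x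
    by (simp_all add: R_def Proj_Proj_subset MN M N Proj_idem)
  have D: "D z = Proj M (Proj N z) - R z" for z by (simp add: D_def R_def blinfun.diff_left)
  \<comment> \<open>For \<open>n = 0\<close> the difference to be bounded is \<open>x - R x\<close>
    and not \<open>x\<close>, so \<open>D\<close> is iterated on \<open>z\<close>.\<close>
  define z where "z = x - R x"
  have "R z = 0" by (simp add: z_def blinfun.diff_right abs)
  have "((Proj M \<circ> Proj N) ^^ n) x = R x + (blinfun_apply D ^^ n) z \<and> R ((blinfun_apply D ^^ n) z) = 0" for n
  proof (induction n)
    case (Suc n)
    define w where "w = (blinfun_apply D ^^ n) z"
    have "((Proj M \<circ> Proj N) ^^ Suc n) x = Proj M (Proj N (R x + w))"
      unfolding w_def Suc[THEN conjunct1, symmetric] by simp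
    moreover have "R w = 0" unfolding w_def by (rule Suc[THEN conjunct2])
    then have "Proj M (Proj N (R x + w)) = R x + D w" by (simp add: blinfun.add_right abs D)
    ultimately have "((Proj M \<circ> Proj N) ^^ Suc n) x = R x + D w" by (simp only:)
    moreover have "R (D w) = 0" by (simp add: D blinfun.diff_right abs)
    moreover have "(blinfun_apply D ^^ Suc n) z = D w" by (simp add: w_def)
    ultimately show ?case by (simp only:)
  qed (use \<open>R z = 0\<close> in \<open>simp add: z_def\<close>)
  moreover have "norm ((blinfun_apply D ^^ n) z) \<le> norm D ^ n * norm z"
  proof (induction n)
    case (Suc n)
    have "norm ((blinfun_apply D ^^ Suc n) z) \<le> norm D * norm ((blinfun_apply D ^^ n) z)" by (simp add: norm_blinfun)
    also have "\<dots> \<le> norm D * (norm D ^ n * norm z)" using Suc by (intro mult_left_mono) auto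
    finally show ?case by simp
  qed simp
  moreover have "norm z \<le> norm x"
    using norm_Proj_le[OF compl_perp(1)[OF MN], of x] by (simp add: z_def R_def compl_perp(2) MN)
  then have "norm D ^ n * norm z \<le> norm D ^ n * norm x" by (intro mult_left_mono) auto
  ultimately show ?thesis by (simp add: R_def)
qed

lemma bounded_linear_funpow: "bounded_linear f \<Longrightarrow> bounded_linear (f ^^ n)" for f :: "'x \<Rightarrow> 'x"
  by (induction n) (auto simp: comp_def bounded_linear_compose bounded_linear_ident id_def)

lemma norm_less_imp_onorm_Cauchy:
  assumes M: "compl M" and N: "compl N" and MN: "compl (M \<inter> N)"
    and less: "norm ((Proj M o\<^sub>L Proj N) - Proj (M \<inter> N)) < 1"
  shows "onorm_Cauchy (\<lambda>n. (Proj M \<circ> Proj N) ^^ n)"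
  unfolding onorm_Cauchy_def
proof (intro allI impI)
  fix e :: real assume e: "e > 0"
  define d where "d = norm ((Proj M o\<^sub>L Proj N) - Proj (M \<inter> N))"
  have d: "0 \<le> d" "d < 1" using less by (auto simp: d_def)
  obtain k where k: "d ^ k < e / 2" using real_arch_pow_inv[of "e / 2" d] e d by auto
  show "\<exists>k. \<forall>m\<ge>k. \<forall>n\<ge>k. onorm (\<lambda>x. ((Proj M \<circ> Proj N) ^^ m) x - ((Proj M \<circ> Proj N) ^^ n) x) < e"
  proof (intro exI allI impI)
    fix m n assume mn: "m \<ge> k" "n \<ge> k"
    have "onorm (\<lambda>x. ((Proj M \<circ> Proj N) ^^ m) x - ((Proj M \<circ> Proj N) ^^ n) x) \<le> d ^ m + d ^ n"
    proof (rule onorm_bound)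
      fix x
      show "norm (((Proj M \<circ> Proj N) ^^ m) x - ((Proj M \<circ> Proj N) ^^ n) x) \<le> (d ^ m + d ^ n) * norm x"
        using norm_triangle_ineq4[of "((Proj M \<circ> Proj N) ^^ m) x - Proj (M \<inter> N) x"
            "((Proj M \<circ> Proj N) ^^ n) x - Proj (M \<inter> N) x"]
          funpow_Proj_Proj[OF M N MN, of m x] funpow_Proj_Proj[OF M N MN, of n x]
        by (simp add: d_def distrib_right)
    qed (use d in simp)
    also have "\<dots> \<le> d ^ k + d ^ k" using mn d by (intro add_mono power_decreasing) auto
    finally show "onorm (\<lambda>x. ((Proj M \<circ> Proj N) ^^ m) x - ((Proj M \<circ> Proj N) ^^ n) x) < e" using k by simp
  qed
qed

text \<open>The limit \<open>L\<close> has its values among the fixed points of P Q, that is in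
  \<open>M \<inter> N\<close>, and preserves inner products with vectors there, so it is the
  projection. For a power close to \<open>L\<close>, 1 minus this power maps
  \<open>perp (M \<inter> N)\<close> onto itself, while its range lies in
  \<open>perp M + perp N\<close>.\<close>

lemma onorm_Cauchy_imp_direct_sum:
  assumes M: "compl M" and N: "compl N" and cauchy: "onorm_Cauchy (\<lambda>n. (Proj M \<circ> Proj N) ^^ n)"
  shows "direct_sum (M \<inter> N) (perp M + perp N)"
proof -
  define G where "G = (\<lambda>n. (Proj M \<circ> Proj N) ^^ n)"
  have blG: "bounded_linear (G n)" for n
    unfolding G_def by (intro bounded_linear_funpow)
      (simp add: comp_def bounded_linear_compose[OF blinfun.bounded_linear_right blinfun.bounded_linear_right])
  define B where "B n = Blinfun (G n)" for n
  have B: "blinfun_apply (B n) = G n" for n by (simp add: B_def bounded_linear_Blinfun_apply blG)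
  have "Cauchy B"
    unfolding Cauchy_def dist_norm
    using cauchy by (simp add: onorm_Cauchy_def norm_blinfun.rep_eq minus_blinfun.rep_eq B G_def)
  then obtain L where L: "B \<longlonglongrightarrow> L" using Cauchy_convergent_iff convergent_def by blast
  have lim: "(\<lambda>n. G n x) \<longlonglongrightarrow> L x" for x
    using blinfun.tendsto[OF L tendsto_const, of x] by (simp add: B)
  have LMN: "L x \<in> M \<inter> N" for x
  proof (rule Proj_Proj_fix[OF M N])
    have "(\<lambda>n. Proj M (Proj N (G n x))) \<longlonglongrightarrow> Proj M (Proj N (L x))"
      by (intro blinfun.tendsto tendsto_const lim)
    moreover have "(\<lambda>n. Proj M (Proj N (G n x))) \<longlonglongrightarrow> L x"
      using LIMSEQ_Suc[OF lim[of x]] by (simp add: G_def)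
    ultimately show "Proj M (Proj N (L x)) = L x" by (rule LIMSEQ_unique)
  qed
  have ipG: "ip (G n x) r = ip x r" if r: "r \<in> M \<inter> N" for n x r
  proof (induction n)
    case (Suc n)
    have "ip (G (Suc n) x) r = ip (G n x) (Proj N (Proj M r))"
      by (simp add: G_def selfadjointD[OF Proj_selfadjoint] M N)
    then show ?case using Suc r Proj_fix_iff[OF M, of r] Proj_fix_iff[OF N, of r] by simp
  qed (simp add: G_def)
  have Lperp: "x - L x \<in> perp (M \<inter> N)" for x
  proof -
    have "ip (L x) r = ip x r" if r: "r \<in> M \<inter> N" for r
    proof (rule LIMSEQ_unique)
      show "(\<lambda>n. ip (G n x) r) \<longlonglongrightarrow> ip (L x) r" by (intro ip.tendsto lim tendsto_const)
      show "(\<lambda>n. ip (G n x) r) \<longlonglongrightarrow> ip x r" using ipG[OF r] by simp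
    qed
    then show ?thesis by (simp add: orth_def ip.diff_left)
  qed
  have MN: "compl (M \<inter> N)"
    using LMN Lperp submodule_Int[OF M N] by (intro complI) blast+
  have LR: "L x = Proj (M \<inter> N) x" for x
    using proj_unique[OF MN LMN Lperp] by (simp add: Proj_apply MN)
  obtain n where n: "norm (B n - L) < 1"
    using LIMSEQ_D[OF L, of 1] by auto
  define V where "V = perp (M \<inter> N)"
  have BV: "(B n - L) x \<in> V" for x
  proof -
    have "ip (G n x - L x) r = 0" if "r \<in> M \<inter> N" for r
      using ipG[OF that] perpD(1)[OF Lperp that, of x] by (simp add: ip.diff_left)
    then show ?thesis by (simp add: V_def orth_def blinfun.diff_left B)
  qed
  \<comment> \<open>The difference telescopes into vectors of the form y - P Q y.\<close>
  have ran: "x - G m x \<in> perp M + perp N" for m x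
  proof (induction m)
    case 0
    then show ?case by (simp add: G_def subspace_0 subspace_set_plus perp_subspace)
  next
    case (Suc m)
    have "(x - G m x) + (G m x - Proj M (Proj N (G m x))) \<in> perp M + perp N"
      by (intro subspace_add subspace_set_plus perp_subspace Suc diff_Proj_Proj_mem M N)
    then show ?case by (simp add: G_def)
  qed
  have onto: "(\<lambda>x. x + (L - B n) x) ` V = V"
  proof (rule surj_on_perturb[where e = 1 and k = "norm (L - B n)"])
    show "(L - B n) ` V \<subseteq> V"
    proof
      fix y assume "y \<in> (L - B n) ` V"
      then obtain x where "y = - ((B n - L) x)" by (auto simp: blinfun.diff_left)
      then show "y \<in> V" using BV[of x] perp_subspace unfolding V_def by (simp add: subspace_neg)
    qed
  qed (use n in \<open>auto simp: V_def norm_minus_commute perp_closed perp_subspace norm_blinfun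
      intro: bounded_linear_ident blinfun.bounded_linear_right\<close>)
  show ?thesis
  proof (rule direct_sum_IntI[OF _ zero_mem_Int[OF M N]])
    fix x
    have "x - L x \<in> V" using Lperp by (simp add: V_def)
    then obtain z where z: "z \<in> V" "x - L x = z + (L - B n) z" using onto by (metis (no_types, lifting) imageE)
    have "L z = 0" using z(1) by (simp add: LR V_def Proj_0_iff MN)
    then have "x - L x = z - G n z" using z(2) by (simp add: blinfun.diff_left B)
    then show "\<exists>y\<in>M \<inter> N. x - y \<in> perp M + perp N" using LMN ran by metis
  qed
qed

lemma norm_less_imp_bij_betw:
  assumes M: "compl M" and N: "compl N" and MN: "compl (M \<inter> N)"
    and less: "norm ((Proj M o\<^sub>L Proj N) - Proj (M \<inter> N)) < 1"
  shows "bij_betw (\<lambda>x. x - Proj M (Proj N x)) (perp (M \<inter> N)) (perp (M \<inter> N))"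
proof -
  define R where "R = Proj (M \<inter> N)"
  have abs: "R (Proj M x) = R x" "R (Proj N x) = R x" "R (R x) = R x" for x
    by (simp_all add: R_def Proj_Proj_subset MN M N Proj_idem)
  define V where "V = perp (M \<inter> N)"
  have RV: "R x = 0 \<longleftrightarrow> x \<in> V" for x by (simp add: R_def V_def Proj_0_iff MN)
  define D where "D = R - (Proj M o\<^sub>L Proj N)"
  have "(\<lambda>x. x + D x) ` V = V"
  proof (rule surj_on_perturb[where e = 1 and k = "norm D"])
    show "D ` V \<subseteq> V"
      by (auto simp: D_def blinfun.bilinear_simps abs simp flip: RV)
  qed (use less in \<open>auto simp: V_def D_def R_def norm_minus_commute perp_closed perp_subspace norm_blinfun
      intro: bounded_linear_ident blinfun.bounded_linear_right\<close>)
  moreover have "x + D x = x - Proj M (Proj N x)" if "x \<in> V" for x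
    using that RV by (simp add: D_def blinfun.diff_left)
  ultimately have "(\<lambda>x. x - Proj M (Proj N x)) ` V = V" by (metis (no_types, lifting) image_cong)
  moreover have "inj_on (\<lambda>x. x - Proj M (Proj N x)) V"
  proof (rule inj_onI)
    fix x y assume xy: "x \<in> V" "y \<in> V" "x - Proj M (Proj N x) = y - Proj M (Proj N y)"
    have "Proj M (Proj N (x - y)) = x - y" using xy(3) by (simp add: blinfun.diff_right algebra_simps)
    then have "x - y \<in> M \<inter> N" by (rule Proj_Proj_fix[OF M N])
    moreover have "x - y \<in> V" using xy unfolding V_def by (intro subspace_diff perp_subspace)
    ultimately show "x = y" using perp_self[of "x - y" "M \<inter> N"] by (simp add: V_def)
  qed
  ultimately show ?thesis by (simp add: bij_betw_def V_def)
qed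

lemma bij_betw_imp_closed_range:
  assumes M: "compl M" and N: "compl N" and MN: "compl (M \<inter> N)"
    and bij: "bij_betw (\<lambda>x. x - Proj M (Proj N x)) (perp (M \<inter> N)) (perp (M \<inter> N))"
  shows "closed (range (\<lambda>x. x - Proj M (Proj N x)))"
proof -
  let ?f = "\<lambda>x. x - Proj M (Proj N x)" and ?R = "Proj (M \<inter> N)"
  have "?f x = ?f (x - ?R x)" for x
    by (simp add: blinfun.diff_right Proj_Proj_subset MN M N)
  moreover have "x - ?R x \<in> perp (M \<inter> N)" for x by (intro Proj_mem MN)
  ultimately have "range ?f = ?f ` perp (M \<inter> N)" by (blast intro: image_eqI)
  also have "\<dots> = perp (M \<inter> N)" using bij by (simp add: bij_betw_def)
  finally show ?thesis using perp_closed by simp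
qed

text \<open>The closed range theorem splits \<open>X\<close> into the range of 1 - P Q, which lies
  in \<open>perp M + perp N\<close>, and the kernel of 1 - Q P, whose elements are fixed by Q P and
  thus lie in \<open>N \<inter> M\<close>.\<close>

lemma closed_range_imp_direct_sum:
  assumes M: "compl M" and N: "compl N" and cl: "closed (range (\<lambda>x. x - Proj M (Proj N x)))"
  shows "direct_sum (M \<inter> N) (perp M + perp N)"
proof (rule direct_sum_IntI[OF _ zero_mem_Int[OF M N]])
  fix x
  define T where "T = id_blinfun - (Proj M o\<^sub>L Proj N)"
  define T' where "T' = id_blinfun - (Proj N o\<^sub>L Proj M)"
  have adj: "adjoint_pair T T'"
    unfolding T_def T'_def
    by (intro adjoint_pair_diff adjoint_pair_Proj_Proj M N) (simp add: adjoint_pair_def)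
  have "range T = range (\<lambda>x. x - Proj M (Proj N x))" by (simp add: T_def blinfun.diff_left)
  then have "closed (range T)" using cl by simp
  then obtain y where y: "T' (x - T y) = 0" using adjoint_closed_range(3)[OF adj] by blast
  then have "Proj N (Proj M (x - T y)) = x - T y" by (simp add: T'_def blinfun.diff_left)
  then have "x - T y \<in> N \<inter> M" by (rule Proj_Proj_fix[OF N M])
  moreover have "T y \<in> perp M + perp N"
    using diff_Proj_Proj_mem[OF M N, of y] by (simp add: T_def blinfun.diff_left)
  ultimately show "\<exists>z\<in>M \<inter> N. x - z \<in> perp M + perp N" by (intro bexI[of _ "x - T y"]) auto
qed

end

section \<open>Ranges of operators with a spectral gap\<close>

lemma subspace_closure:
  fixes S :: "'a::real_normed_vector set"
  assumes S: "subspace S"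
  shows "subspace (closure S)"
proof (rule subspaceI)
  show "0 \<in> closure S" using subspace_0[OF S] closure_subset by blast
  show "x + y \<in> closure S" if xy: "x \<in> closure S" "y \<in> closure S" for x y
  proof -
    obtain f g where "\<And>n. f n \<in> S" "f \<longlonglongrightarrow> x" "\<And>n. g n \<in> S" "g \<longlonglongrightarrow> y"
      using xy unfolding closure_sequential by blast
    then have "(\<lambda>n. f n + g n) \<longlonglongrightarrow> x + y" "\<And>n. f n + g n \<in> S"
      using subspace_add[OF S] by (auto intro: tendsto_add)
    then show ?thesis unfolding closure_sequential by (intro exI[of _ "\<lambda>n. f n + g n"]) simp
  qed
  show "c *\<^sub>R x \<in> closure S" if x: "x \<in> closure S" for c x
  proof -
    obtain f where "\<And>n. f n \<in> S" "f \<longlonglongrightarrow> x" using x unfolding closure_sequential by blast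
    then have "(\<lambda>n. c *\<^sub>R f n) \<longlonglongrightarrow> c *\<^sub>R x" "\<And>n. c *\<^sub>R f n \<in> S"
      using subspace_scale[OF S] by (auto intro: tendsto_scaleR)
    then show ?thesis unfolding closure_sequential by (intro exI[of _ "\<lambda>n. c *\<^sub>R f n"]) simp
  qed
qed

context hilbert_module
begin

lemma image_closure_subset_closure:
  fixes f :: "'x \<Rightarrow> 'x"
  assumes "bounded_linear f" "f ` S \<subseteq> S"
  shows "f ` closure S \<subseteq> closure S"
  using image_closure_subset[of S f "closure S"] assms closure_subset[of S]
  by (auto intro: linear_continuous_on)

text \<open>The range of \<open>D\<close> is not known to be closed, so the lower bound is extended
  to its closure, which \<open>D\<close> then maps onto itself. Hence D x = D w for some w in the
  closure, and this w is again a value of \<open>D\<close>.\<close>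

lemma selfadjoint_range_complement:
  assumes D: "selfadjoint D" and \<delta>: "\<delta> > 0" "\<And>x. \<delta> * norm (D x) \<le> norm (D (D x))"
  shows "\<exists>v. D (x - D v) = 0"
proof -
  define V where "V = closure (range D)"
  have DV: "D ` V \<subseteq> V"
    unfolding V_def by (intro image_closure_subset_closure blinfun.bounded_linear_right) auto
  have "D ` V = V"
  proof (rule selfadjoint_surj_on)
    show "closed V" "subspace V"
      unfolding V_def by (simp_all add: subspace_closure subspace_range_blinfun)
    show "c *\<^sub>C x \<in> V" if "x \<in> V" for c x
    proof -
      have "(\<lambda>x. c *\<^sub>C x) ` range D \<subseteq> range D"
        by (auto simp flip: selfadjoint_scaleC[OF D])
      then have "(\<lambda>x. c *\<^sub>C x) ` V \<subseteq> V"
        unfolding V_def by (intro image_closure_subset_closure bounded_linear_scaleC)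
      then show ?thesis using that by blast
    qed
    have cont: "continuous_on UNIV (\<lambda>y. norm (D y))" "continuous_on UNIV (\<lambda>y :: 'x. \<delta> * norm y)"
      by (intro continuous_intros linear_continuous_on blinfun.bounded_linear_right)+
    have "closed {y. \<delta> * norm y \<le> norm (D y)}"
      by (rule closed_Collect_le[OF cont(2,1)])
    then have "V \<subseteq> {y. \<delta> * norm y \<le> norm (D y)}"
      unfolding V_def using \<delta>(2) by (intro closure_minimal) auto
    then show "\<delta> * norm y \<le> norm (D y)" if "y \<in> V" for y using that by blast
  qed (rule D DV \<delta>(1))+
  moreover have "D x \<in> V" unfolding V_def by (rule subsetD[OF closure_subset rangeI])
  ultimately have "D x \<in> D ` V" by simp
  then obtain w where w: "D x = D w" "w \<in> V" by (rule imageE)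
  then have "w \<in> D ` V" using \<open>D ` V = V\<close> by simp
  then obtain v where "w = D v" by (rule imageE)
  then have "D (x - D v) = 0" using w by (simp add: blinfun.diff_right)
  then show ?thesis ..
qed

text \<open>The identity for D^2 expresses that \<open>D\<close> has no spectrum strictly between 0
  and \<delta>. With the root \<open>d\<close> of \<open>D\<close> it becomes a sum of squares,
  \<delta> d^2 + K^2 = D^2.\<close>

lemma selfadjoint_gap:
  assumes D: "selfadjoint D" "norm (id_blinfun - D) \<le> 1" and \<delta>: "\<delta> > 0"
    and K: "selfadjoint K" "\<And>x. D (D x) = \<delta> *\<^sub>R D x + K (K x)" "\<And>B. commutes B D \<Longrightarrow> commutes B K"
  shows "\<delta> * norm (D x) \<le> norm (D (D x))"
proof -
  obtain d where d: "selfadjoint d" "\<And>x. d (d x) = D x" "\<And>B. commutes B D \<Longrightarrow> commutes B d"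
    using selfadjoint_root[OF D] by metis
  have dD: "commutes d D" using d(3)[of D] commutes_sym commutes_intros(3) by blast
  have dK: "commutes d K" by (rule K(3)[OF dD])
  have *: "sqrt \<delta> * norm (d x) \<le> norm (D x)" for x
  proof -
    have "(norm ((sqrt \<delta> *\<^sub>R d) x))\<^sup>2
        \<le> norm (ip x ((sqrt \<delta> *\<^sub>R d) ((sqrt \<delta> *\<^sub>R d) x) + K (K x)))"
      by (intro norm_le_sum_squares selfadjoint_intros d(1) K(1))
        (use dK in \<open>simp add: commutes_def blinfun.bilinear_simps\<close>)
    also have "(sqrt \<delta> *\<^sub>R d) ((sqrt \<delta> *\<^sub>R d) x) + K (K x) = D (D x)"
      using \<delta> by (simp add: blinfun.bilinear_simps d(2) K(2))
    also have "ip x (D (D x)) = ip (D x) (D x)" by (rule selfadjointD[OF D(1), symmetric])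
    also have "norm \<dots> = (norm (D x))\<^sup>2" by (rule norm_ip_self)
    finally have "norm ((sqrt \<delta> *\<^sub>R d) x) \<le> norm (D x)" by (rule power2_le_imp_le) simp
    then show ?thesis using \<delta> by (simp add: blinfun.bilinear_simps)
  qed
  \<comment> \<open>The estimate is applied at \<open>d x\<close> and then at \<open>D x\<close>;
    each use contributes one factor \<open>sqrt \<delta>\<close>.\<close>
  have "sqrt \<delta> * norm (D x) \<le> norm (d (D x))"
    using *[of "d x"] by (simp add: d(2) flip: commutesD[OF dD])
  then have "sqrt \<delta> * (sqrt \<delta> * norm (D x)) \<le> sqrt \<delta> * norm (d (D x))"
    using \<delta> by (intro mult_left_mono) auto
  also have "\<dots> \<le> norm (D (D x))" by (rule *)
  finally show ?thesis using \<delta> by (simp flip: mult.assoc)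
qed

text \<open>A vector fixed by Q P Q is fixed by Q and so by Q P, which places the kernel of
  \<open>D\<close> in \<open>M \<inter> N\<close>.\<close>

lemma range_complement_imp_direct_sum:
  assumes M: "compl M" and N: "compl N"
    and D: "D = id_blinfun - (Proj N o\<^sub>L Proj M o\<^sub>L Proj N)" "\<And>x. \<exists>v. D (x - D v) = 0"
  shows "direct_sum (M \<inter> N) (perp M + perp N)"
proof (rule direct_sum_IntI[OF _ zero_mem_Int[OF M N]])
  fix x
  obtain v where v: "D (x - D v) = 0" using D(2) by blast
  define z where "z = x - D v"
  have z: "Proj N (Proj M (Proj N z)) = z" using v by (simp add: D(1) z_def blinfun.diff_left)
  then have Nz: "Proj N z = z" using Proj_idem[OF N] by metis
  then have "z \<in> N \<inter> M" using z by (intro Proj_Proj_fix[OF N M]) simp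
  moreover have "D v \<in> perp M + perp N"
  proof -
    have "v - Proj N (Proj M v) \<in> perp N + perp M" for v
      by (rule diff_Proj_Proj_mem[OF N M])
    then have 1: "Proj N v - Proj N (Proj M (Proj N v)) \<in> perp N + perp M" by blast
    moreover have "v - Proj N v \<in> perp N + perp M"
      by (intro mem_set_plus_left Proj_mem N subspace_0 perp_subspace)
    ultimately have "(v - Proj N v) + (Proj N v - Proj N (Proj M (Proj N v))) \<in> perp N + perp M"
      by (intro subspace_add subspace_set_plus perp_subspace)
    then show ?thesis by (simp add: D(1) blinfun.diff_left add.commute)
  qed
  ultimately show "\<exists>y\<in>M \<inter> N. x - y \<in> perp M + perp N" by (intro bexI[of _ z]) (auto simp: z_def)
qed

end

section \<open>Hilbert spaces as Hilbert modules over the complex numbers\<close>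

lemma hilbert_space_module:
  "hilbert_module (\<lambda>(x :: 'k::complex_hilbert_space) (c :: complex). c *\<^sub>C x) cinner"
proof
  fix x y z :: 'k and a b c :: complex
  show "cstar_positive (cinner x x)"
    unfolding cstar_positive_def
    by (intro exI[of _ "complex_of_real (norm x)"])
      (simp add: star_complex_def cinner_self power2_eq_square)
  show "norm x = sqrt (norm (cinner x x))" by (simp add: cinner_self norm_power)
qed (simp_all add: scaleC_add_right scaleC_add_left scaleC_scaleC scaleC_complex_def star_complex_def
    cinner_add_right cinner_scaleC_right mult.commute, metis cinner_commute)

interpretation hs: hilbert_module "\<lambda>(x :: 'k::complex_hilbert_space) (c :: complex). c *\<^sub>C x" cinner
  by (rule hilbert_space_module)

lemma Re_cinner_self: "Re (cinner x x) = (norm x)\<^sup>2"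
  by (simp add: cinner_self)

lemma norm_diff_scaleC_power2:
  "(norm (z - c *\<^sub>C u))\<^sup>2 = (norm z)\<^sup>2 - 2 * Re (c * cinner z u) + (cmod c)\<^sup>2 * (norm u)\<^sup>2"
proof -
  have "cinner (z - c *\<^sub>C u) (z - c *\<^sub>C u)
      = cinner z z - (c * cinner z u + cnj (c * cinner z u)) + (cnj c * c) * cinner u u"
    using cinner_commute[of u z]
    by (simp add: hs.ip.diff_left hs.ip.diff_right cinner_scaleC_right hs.ip_scaleC_left
        scaleC_complex_def algebra_simps)
  also have "Re \<dots> = (norm z)\<^sup>2 - 2 * Re (c * cinner z u) + (cmod c)\<^sup>2 * (norm u)\<^sup>2"
    by (simp add: Re_cinner_self cinner_self complex_norm_square[symmetric] mult.commute[of "cnj c"])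
  finally show ?thesis by (simp only: Re_cinner_self)
qed

lemma norm_parallelogram:
  "(norm (x + y))\<^sup>2 + (norm (x - y))\<^sup>2 = 2 * (norm x)\<^sup>2 + 2 * (norm y)\<^sup>2" for x y :: "'k::complex_hilbert_space"
  using norm_diff_scaleC_power2[of x 1 y] norm_diff_scaleC_power2[of x "- 1" y]
  by (simp add: scaleC_minus_left)

text \<open>Unlike in a general Hilbert module, the parallelogram law makes a minimising sequence
  Cauchy, so a nearest point exists. This provides the projection onto the intersection of two
  localised submodules.\<close>

theorem closed_submodule_complemented:
  fixes U :: "'k::complex_hilbert_space set"
  assumes U: "submodule (\<lambda>x c :: complex. c *\<^sub>C x) U" "closed U"
  shows "hs.compl U"
proof (rule hs.complI[OF U])
  fix x :: 'k
  have sU: "subspace U" by (rule hs.submodule_subspace[OF U(1)])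
  define S where "S = (\<lambda>u. (norm (x - u))\<^sup>2) ` U"
  define d where "d = Inf S"
  have bdd: "bdd_below S" by (auto simp: S_def intro!: bdd_belowI[of _ 0])
  have ne: "S \<noteq> {}" using subspace_0[OF sU] by (auto simp: S_def)
  have d_le: "d \<le> (norm (x - u))\<^sup>2" if "u \<in> U" for u
    unfolding d_def by (rule cInf_lower[OF _ bdd]) (use that in \<open>auto simp: S_def\<close>)
  have "\<exists>u\<in>U. (norm (x - u))\<^sup>2 < d + 1 / real (Suc n)" for n
    using cInf_lessD[OF ne, of "d + 1 / real (Suc n)"] by (auto simp: S_def d_def)
  then obtain u where u: "\<And>n. u n \<in> U" "\<And>n. (norm (x - u n))\<^sup>2 < d + 1 / real (Suc n)" by metis
  have mid: "(norm (u m - u n))\<^sup>2 \<le> 2 / real (Suc m) + 2 / real (Suc n)" for m n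
  proof -
    have "(1 / 2) *\<^sub>R (u m + u n) \<in> U" using u(1) sU by (intro subspace_scale subspace_add)
    then have "d \<le> (norm (x - (1 / 2) *\<^sub>R (u m + u n)))\<^sup>2" by (rule d_le)
    also have "x - (1 / 2) *\<^sub>R (u m + u n) = (1 / 2) *\<^sub>R ((x - u n) + (x - u m))"
      by (simp add: algebra_simps flip: scaleR_2)
    finally have "4 * d \<le> (norm ((x - u n) + (x - u m)))\<^sup>2" by (simp add: power_divide)
    moreover have "(norm ((x - u n) + (x - u m)))\<^sup>2 + (norm (u m - u n))\<^sup>2
        = 2 * (norm (x - u n))\<^sup>2 + 2 * (norm (x - u m))\<^sup>2"
      using norm_parallelogram[of "x - u n" "x - u m"] by simp
    ultimately show ?thesis using u(2)[of m] u(2)[of n] by simp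
  qed
  have "Cauchy u"
    unfolding Cauchy_def dist_norm
  proof (intro allI impI)
    fix e :: real assume e: "e > 0"
    obtain k where k: "inverse (real (Suc k)) < e\<^sup>2 / 4" using reals_Archimedean[of "e\<^sup>2 / 4"] e by auto
    show "\<exists>k. \<forall>m\<ge>k. \<forall>n\<ge>k. norm (u m - u n) < e"
    proof (intro exI allI impI)
      fix m n assume mn: "m \<ge> k" "n \<ge> k"
      have "1 / real (Suc j) < e\<^sup>2 / 4" if "j \<ge> k" for j
        using le_less_trans[OF _ k, of "inverse (real (Suc j))"] that by (simp add: inverse_eq_divide frac_le)
      from this[OF mn(1)] this[OF mn(2)] mid[of m n] have "(norm (u m - u n))\<^sup>2 < e\<^sup>2" by simp
      then show "norm (u m - u n) < e" using e by (simp add: power2_less_imp_less)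
    qed
  qed
  then obtain y where y: "u \<longlonglongrightarrow> y" using Cauchy_convergent_iff convergent_def by blast
  have yU: "y \<in> U" using closed_sequentially[OF U(2)] u(1) y by blast
  have "(norm (x - y))\<^sup>2 \<le> d + 0"
  proof (rule LIMSEQ_le)
    show "(\<lambda>n. (norm (x - u n))\<^sup>2) \<longlonglongrightarrow> (norm (x - y))\<^sup>2" by (intro tendsto_intros y)
    show "(\<lambda>n. d + 1 / real (Suc n)) \<longlonglongrightarrow> d + 0"
      using LIMSEQ_inverse_real_of_nat by (intro tendsto_intros) (simp add: inverse_eq_divide)
    show "\<exists>N. \<forall>n\<ge>N. (norm (x - u n))\<^sup>2 \<le> d + 1 / real (Suc n)" using u(2) less_imp_le by blast
  qed
  then have min: "(norm (x - y))\<^sup>2 \<le> (norm (x - v))\<^sup>2" if "v \<in> U" for v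
    using d_le[OF that] by linarith
  have "cinner (x - y) v = 0" if v: "v \<in> U" for v
  proof -
    define a where "a = cinner (x - y) v"
    \<comment> \<open>Moving \<open>y\<close> along \<open>v\<close> changes the squared distance by
      \<open>t * (cmod a)\<^sup>2 * (t * (norm v)\<^sup>2 - 2)\<close>. This \<open>t\<close> makes
      the last factor negative; the summand 1 covers \<open>v = 0\<close>.\<close>
    define t where "t = 1 / ((norm v)\<^sup>2 + 1)"
    have t: "t > 0" by (simp add: t_def add_nonneg_pos)
    have "y + (of_real t * cnj a) *\<^sub>C v \<in> U"
      using U(1) v yU by (simp add: submodule_def)
    then have "(norm (x - y))\<^sup>2 \<le> (norm ((x - y) - (of_real t * cnj a) *\<^sub>C v))\<^sup>2"
      using min by (simp add: diff_diff_eq)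
    also have "\<dots> = (norm (x - y))\<^sup>2 - 2 * (t * (cmod a)\<^sup>2) + (t * cmod a)\<^sup>2 * (norm v)\<^sup>2"
    proof -
      have "Re (of_real t * cnj a * a) = t * (cmod a)\<^sup>2"
        unfolding cmod_power2 by (simp add: power2_eq_square algebra_simps)
      then show ?thesis
        using t unfolding norm_diff_scaleC_power2 a_def[symmetric] by (simp add: norm_mult)
    qed
    finally have "0 \<le> t * (cmod a)\<^sup>2 * (t * (norm v)\<^sup>2 - 2)" by (simp add: power2_eq_square algebra_simps)
    moreover have "t * (norm v)\<^sup>2 - 2 < 0"
      unfolding t_def by (simp add: divide_less_eq add_nonneg_pos)
    ultimately have "(cmod a)\<^sup>2 \<le> 0" using t by (simp add: zero_le_mult_iff mult_le_0_iff)
    then show ?thesis by (simp add: a_def)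
  qed
  then have "x - y \<in> hs.perp U" by (simp add: orth_def)
  with yU show "\<exists>y\<in>U. x - y \<in> hs.perp U" by blast
qed

section \<open>Localisation\<close>

locale localisation = hilbert_module act ip
  for act :: "'x::complex_banach \<Rightarrow> 'b::cstar_algebra \<Rightarrow> 'x" and ip +
  fixes \<pi> :: "'b \<Rightarrow> 'h::complex_hilbert_space \<Rightarrow> 'h"
    and \<tau> :: "'x \<Rightarrow> 'h \<Rightarrow> 'k::complex_hilbert_space"
  assumes faithful: "faithful_representation \<pi>"
    and tensor: "interior_tensor_product act ip \<pi> \<tau>"
begin

abbreviation loc :: "'x set \<Rightarrow> 'k set"
  where "loc \<equiv> localise \<tau>"

lemma \<tau>_add: "\<tau> (x + y) h = \<tau> x h + \<tau> y h"
  and \<tau>_scaleC: "\<tau> (c *\<^sub>C x) h = c *\<^sub>C \<tau> x h"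
  and cinner_\<tau>: "cinner (\<tau> x h) (\<tau> y k) = cinner h (\<pi> (ip x y) k)"
  and \<tau>_dense: "closure (span {\<tau> x h |x h. True}) = UNIV"
  using tensor by (simp_all add: interior_tensor_product_def)

lemma \<tau>_scaleR: "\<tau> (r *\<^sub>R x) h = r *\<^sub>R \<tau> x h"
  using \<tau>_scaleC[of "complex_of_real r" x h] by (simp add: scaleC_of_real)

lemma \<tau>_diff: "\<tau> (x - y) h = \<tau> x h - \<tau> y h"
  using \<tau>_add[of "x - y" y h] by simp

lemma \<pi>_add: "\<pi> (a + b) h = \<pi> a h + \<pi> b h"
  and \<pi>_scaleC: "\<pi> (c *\<^sub>C b) h = c *\<^sub>C \<pi> b h"
  using faithful by (simp_all add: faithful_representation_def representation_def)

lemma \<pi>_scaleR: "\<pi> (r *\<^sub>R b) h = r *\<^sub>R \<pi> b h"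
  using \<pi>_scaleC[of "complex_of_real r" b h] by (simp add: scaleC_of_real)

text \<open>Injectivity of \<open>\<pi>\<close> enters here: for a = \<open>ip x x\<close> the
  squared norm of \<open>\<pi> a h\<close> is the inner product of
  \<open>\<tau> x (\<pi> a h)\<close> with \<open>\<tau> x h\<close>.\<close>

lemma \<tau>_injective:
  assumes "\<And>h. \<tau> x h = 0"
  shows "x = 0"
proof -
  have "\<pi> (ip x x) h = \<pi> 0 h" for h
  proof -
    have "cinner (\<pi> (ip x x) h) (\<pi> (ip x x) h) = cinner (\<tau> x (\<pi> (ip x x) h)) (\<tau> x h)"
      by (simp add: cinner_\<tau>)
    then have "\<pi> (ip x x) h = 0" by (simp add: assms hs.ip.zero_left)
    then show ?thesis using \<pi>_scaleR[of 0 0 h] by simp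
  qed
  then have "\<pi> (ip x x) = \<pi> 0" by (rule ext)
  then have "ip x x = 0" using faithful unfolding faithful_representation_def by (blast dest: injD)
  then show ?thesis by simp
qed

lemma loc_mem: "x \<in> S \<Longrightarrow> \<tau> x h \<in> loc S"
  unfolding localise_def by (intro subsetD[OF closure_subset] span_base) blast

lemma loc_induct:
  assumes "\<And>x h. x \<in> S \<Longrightarrow> \<tau> x h \<in> V" "subspace V" "closed V"
  shows "loc S \<subseteq> V"
  unfolding localise_def using assms by (intro closure_minimal span_minimal) auto

lemma loc_compl:
  assumes "compl S"
  shows "hs.compl (loc S)"
proof (rule closed_submodule_complemented)
  have sub: "submodule act S" using assms by (simp add: complemented_def)
  show "closed (loc S)" by (simp add: localise_def)
  have s: "subspace (loc S)" unfolding localise_def by (intro subspace_closure subspace_span)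
  have "c *\<^sub>C z \<in> loc S" if "z \<in> loc S" for c z
  proof -
    interpret c: bounded_linear "\<lambda>z :: 'k. c *\<^sub>C z" by (rule bounded_linear_scaleC)
    have "loc S \<subseteq> (\<lambda>z. c *\<^sub>C z) -` loc S"
    proof (rule loc_induct)
      show "\<tau> x h \<in> (\<lambda>z. c *\<^sub>C z) -` loc S" if "x \<in> S" for x h
        using loc_mem[of "c *\<^sub>C x" S h] sub that by (simp add: \<tau>_scaleC submodule_def)
      show "subspace ((\<lambda>z. c *\<^sub>C z) -` loc S)" using s c.linear by (rule linear_subspace_vimage[rotated])
      show "closed ((\<lambda>z. c *\<^sub>C z) -` loc S)"
        by (intro continuous_closed_vimage linear_continuous_at bounded_linear_scaleC)
          (simp add: localise_def)
    qed
    then show ?thesis using that by blast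
  qed
  then show "submodule (\<lambda>x c :: complex. c *\<^sub>C x) (loc S)"
    using s by (simp add: submodule_def subspace_def)
qed

text \<open>\<open>\<tau> (x - Proj S x) h\<close> is orthogonal to the generators of
  \<open>loc S\<close>. Through this, products of projections on both sides correspond on elementary
  tensors.\<close>

lemma Proj_loc_\<tau>:
  assumes S: "compl S"
  shows "hs.Proj (loc S) (\<tau> x h) = \<tau> (Proj S x) h"
proof -
  have c: "hs.compl (loc S)" using S by (rule loc_compl)
  let ?z = "x - Proj S x"
  have "loc S \<subseteq> hs.perp {\<tau> ?z h}"
  proof (rule loc_induct)
    fix y k assume "y \<in> S"
    then have "ip y ?z = 0" using Proj_mem(2)[OF S] perpD by blast
    moreover have "\<pi> 0 h = 0" using \<pi>_scaleR[of 0 0 h] by simp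
    ultimately show "\<tau> y k \<in> hs.perp {\<tau> ?z h}" by (simp add: orth_def cinner_\<tau> hs.ip.zero_right)
  qed (rule hs.perp_subspace hs.perp_closed)+
  then have "\<tau> ?z h \<in> hs.perp (loc S)" by (auto simp: orth_def hs.ip_commute_0)
  then show ?thesis
    unfolding hs.Proj_apply[OF c]
    by (intro hs.proj_unique c loc_mem Proj_mem S) (simp add: \<tau>_diff)
qed

definition lifts :: "('x \<Rightarrow>\<^sub>L 'x) \<Rightarrow> ('k \<Rightarrow>\<^sub>L 'k) \<Rightarrow> bool"
  where "lifts T S \<longleftrightarrow> (\<forall>x h. S (\<tau> x h) = \<tau> (T x) h)"

text \<open>If \<open>\<parallel>T\<parallel> \<le> t\<close> then \<open>T\<^sup>* T / 4 t\<^sup>2\<close> is a contraction, so that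
  \<open>\<langle>T x, T y\<rangle> / 4 t\<^sup>2 + \<langle>W x, W y\<rangle> = \<langle>x, y\<rangle>\<close> for some \<open>W\<close>. This
  identity passes to sums of elementary tensors without lifting \<open>W\<close>.\<close>

lemma norm_lift_le:
  assumes adj: "adjoint_pair T T'" and lift: "lifts T S" and t: "t > 0" "norm T \<le> t"
  shows "norm S \<le> 2 * t"
proof -
  \<comment> \<open>The bound for adjoints gives \<open>norm T' \<le> 4 * t\<close>, so T' T has
    norm at most \<open>4 * t\<^sup>2\<close>; hence the factor 2 in the conclusion.\<close>
  define c where "c = (2 * t)\<^sup>2"
  have c: "c > 0" using t by (simp add: c_def)
  define A where "A = id_blinfun - (1 / c) *\<^sub>R (T' o\<^sub>L T)"
  have nT': "norm T' \<le> 4 * t"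
  proof (rule norm_blinfun_bound)
    fix y
    have "(norm (T' y))\<^sup>2 \<le> 4 * norm y * norm (T (T' y))" by (rule norm_adjoint_le[OF adj])
    also have "\<dots> \<le> 4 * norm y * (t * norm (T' y))"
      by (intro mult_left_mono order_trans[OF norm_blinfun] mult_right_mono t) auto
    finally show "norm (T' y) \<le> 4 * t * norm y"
      using t by (cases "T' y = 0") (simp_all add: power2_eq_square mult_ac)
  qed (use t in simp)
  have "norm (T' o\<^sub>L T) \<le> norm T' * norm T" by (rule norm_blinfun_compose)
  also have "\<dots> \<le> (4 * t) * t" using nT' t by (intro mult_mono) auto
  finally have "norm (T' o\<^sub>L T) \<le> c" by (simp add: c_def power2_eq_square)
  then have "norm (id_blinfun - A) \<le> 1" using c by (simp add: A_def)
  moreover have "selfadjoint A"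
    unfolding A_def using adjoint_pair_compose[OF adjoint_pair_sym[OF adj] adj]
    by (intro selfadjoint_intros(1,4,5)) (simp add: adjoint_pair_selfadjoint)
  ultimately obtain W where W: "selfadjoint W" "\<And>x. W (W x) = A x" using selfadjoint_root by metis
  have split: "ip x y = (1 / c) *\<^sub>R ip (T x) (T y) + ip (W x) (W y)" for x y
    by (simp add: selfadjointD[OF W(1)] adjoint_pairD[OF adj] W(2))
      (simp add: A_def blinfun.bilinear_simps ip.diff_right ip_scaleR_right)
  define E where "E = {\<tau> x h |x h. True}"
  have bound: "norm (S z) \<le> 2 * t * norm z" if "z \<in> span E" for z
  proof -
    have "\<exists>F r. finite F \<and> F \<subseteq> E \<and> z = (\<Sum>a\<in>F. r a *\<^sub>R a)"
      using that by (auto simp: span_explicit)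
    then obtain F r where F: "finite F" "F \<subseteq> E" and z: "z = (\<Sum>a\<in>F. r a *\<^sub>R a)" by blast
    have "\<forall>a\<in>F. \<exists>x h. a = \<tau> x h" using F by (auto simp: E_def)
    then obtain X H where XH: "\<And>a. a \<in> F \<Longrightarrow> a = \<tau> (X a) (H a)" by metis
    define Y where "Y a = r a *\<^sub>R X a" for a
    have z: "z = (\<Sum>a\<in>F. \<tau> (Y a) (H a))"
      unfolding z by (rule sum.cong) (use XH in \<open>auto simp: Y_def \<tau>_scaleR\<close>)
    define w where "w = (\<Sum>a\<in>F. \<tau> (W (Y a)) (H a))"
    have Sz: "S z = (\<Sum>a\<in>F. \<tau> (T (Y a)) (H a))"
      using lift by (simp add: z blinfun.sum_right lifts_def)
    \<comment> \<open>Inner squares of sums of tensors depend only on the values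
      \<open>ip (f a) (f b)\<close>, so \<open>split\<close> can be inserted term by term. The
      vector \<open>w\<close> serves to recognise the remaining sum as nonnegative.\<close>
    have ss: "cinner (\<Sum>a\<in>F. \<tau> (f a) (H a)) (\<Sum>a\<in>F. \<tau> (f a) (H a))
        = (\<Sum>a\<in>F. \<Sum>b\<in>F. cinner (H a) (\<pi> (ip (f a) (f b)) (H b)))" for f
      unfolding hs.ip.sum_left by (simp only: hs.ip.sum_right cinner_\<tau>)
    have "cinner z z = (\<Sum>a\<in>F. \<Sum>b\<in>F. (1 / c) *\<^sub>R cinner (H a) (\<pi> (ip (T (Y a)) (T (Y b))) (H b))
        + cinner (H a) (\<pi> (ip (W (Y a)) (W (Y b))) (H b)))"
      unfolding z ss by (subst split) (simp add: \<pi>_add \<pi>_scaleR hs.ip.add_right hs.ip_scaleR_right)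
    also have "\<dots> = (1 / c) *\<^sub>R cinner (S z) (S z) + cinner w w"
      unfolding Sz w_def ss by (simp add: sum.distrib scaleR_sum_right)
    finally have "(norm z)\<^sup>2 = (1 / c) * (norm (S z))\<^sup>2 + (norm w)\<^sup>2"
      by (metis Re_cinner_self plus_complex.sel(1) scaleR_complex.sel(1))
    then have "(norm (S z))\<^sup>2 \<le> c * (norm z)\<^sup>2" using c by (simp add: field_simps)
    also have "\<dots> = (2 * t * norm z)\<^sup>2" by (simp add: c_def power_mult_distrib)
    finally show ?thesis by (rule power2_le_imp_le) (use t in simp)
  qed
  have "closed {z. norm (S z) \<le> 2 * t * norm z}"
    by (intro closed_Collect_le continuous_intros linear_continuous_on blinfun.bounded_linear_right)
  then have "closure (span E) \<subseteq> {z. norm (S z) \<le> 2 * t * norm z}"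
    using bound by (intro closure_minimal) auto
  then have "norm (S z) \<le> 2 * t * norm z" for z using \<tau>_dense by (auto simp: E_def)
  then show ?thesis using t by (intro norm_blinfun_bound) auto
qed

end

text \<open>This is D^2 \<ge> \<delta> D as forms, with \<delta> = 1 - c^2. As \<open>D\<close>
  vanishes on \<open>U \<inter> V\<close>, \<open>z\<close> may be replaced by its part
  \<open>y\<close> orthogonal to it, where the form of \<open>D\<close> is the squared norm of
  \<open>y\<close> minus that of P Q y.\<close>

lemma projection_angle_gap:
  fixes U V :: "'k::complex_hilbert_space set"
  assumes U: "hs.compl U" and V: "hs.compl V"
  defines "c \<equiv> norm ((hs.Proj U o\<^sub>L hs.Proj V) - hs.Proj (U \<inter> V))"
    and "D \<equiv> id_blinfun - (hs.Proj V o\<^sub>L hs.Proj U o\<^sub>L hs.Proj V)"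
  assumes c: "c < 1"
  shows "(1 - c\<^sup>2) * Re (cinner z (D z)) \<le> (norm (D z))\<^sup>2"
proof -
  have UV: "hs.compl (U \<inter> V)"
    using hs.submodule_Int[OF U V] by (intro closed_submodule_complemented) auto
  define P where "P = hs.Proj U"
  define Q where "Q = hs.Proj V"
  define R where "R = hs.Proj (U \<inter> V)"
  have abs: "P (R x) = R x" "R (P x) = R x" "Q (R x) = R x" "R (Q x) = R x" "R (R x) = R x" for x
    by (simp_all add: P_def Q_def R_def hs.Proj_Proj_subset UV U V hs.Proj_idem)
  have sa: "cinner (P x) y = cinner x (P y)" "cinner (Q x) y = cinner x (Q y)"
      "cinner (R x) y = cinner x (R y)" for x y
    by (simp_all add: P_def Q_def R_def hs.selfadjointD hs.Proj_selfadjoint U V UV)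
  have D: "D x = x - Q (P (Q x))" for x by (simp add: D_def P_def Q_def blinfun.diff_left)
  define y where "y = z - R z"
  have Ry: "R y = 0" by (simp add: y_def blinfun.diff_right abs)
  have Dz: "D z = D y" by (simp add: y_def D blinfun.diff_right abs)
  have "cinner (R z) (D y) = 0" by (simp add: sa D blinfun.diff_right abs Ry hs.ip.zero_right)
  then have zy: "cinner z (D z) = cinner y (D y)" by (simp add: Dz y_def hs.ip.diff_left)
  have "norm (P (Q y)) \<le> c * norm y"
    using norm_blinfun[of "(P o\<^sub>L Q) - R" y] Ry by (simp add: c_def P_def Q_def R_def blinfun.diff_left)
  then have "(norm (P (Q y)))\<^sup>2 \<le> (c * norm y)\<^sup>2" by (intro power_mono) auto
  then have le: "(norm (P (Q y)))\<^sup>2 \<le> c\<^sup>2 * (norm y)\<^sup>2" by (simp add: power_mult_distrib)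
  have "P (P x) = P x" for x by (simp add: P_def hs.Proj_idem U)
  then have "cinner (P (Q y)) (P (Q y)) = cinner y (Q (P (Q y)))" by (simp add: sa)
  then have "cinner y (D y) = cinner y y - cinner (P (Q y)) (P (Q y))" by (simp add: D hs.ip.diff_right)
  then have s: "Re (cinner y (D y)) = (norm y)\<^sup>2 - (norm (P (Q y)))\<^sup>2" by (simp add: cinner_self)
  define \<delta> where "\<delta> = 1 - c\<^sup>2"
  have "0 \<le> c" by (simp add: c_def)
  then have \<delta>: "\<delta> \<ge> 0" using c by (simp add: \<delta>_def power_le_one)
  have ge: "\<delta> * (norm y)\<^sup>2 \<le> Re (cinner y (D y))" using le by (simp add: s \<delta>_def algebra_simps)
  have "cinner (D y) y = cinner y (D y)" by (simp add: D sa hs.ip.diff_left hs.ip.diff_right)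
  \<comment> \<open>Expanding this square, which is nonnegative, converts the lower bound for
    \<open>D\<close> into one for D^2.\<close>
  then have "(norm (D y - of_real \<delta> *\<^sub>C y))\<^sup>2 = (norm (D y))\<^sup>2 - 2 * \<delta> * Re (cinner y (D y)) + \<delta>\<^sup>2 * (norm y)\<^sup>2"
    using \<delta> by (simp add: norm_diff_scaleC_power2)
  then have "2 * \<delta> * Re (cinner y (D y)) \<le> (norm (D y))\<^sup>2 + \<delta> * (\<delta> * (norm y)\<^sup>2)"
    using zero_le_power2[of "norm (D y - of_real \<delta> *\<^sub>C y)"] by (simp add: power2_eq_square mult.assoc)
  also have "\<dots> \<le> (norm (D y))\<^sup>2 + \<delta> * Re (cinner y (D y))"
    using ge \<delta> by (intro add_left_mono mult_left_mono)
  finally show ?thesis by (simp add: zy flip: \<delta>_def) (simp add: Dz)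
qed

lemma (in hilbert_module) ip_funpow:
  assumes "\<And>x y. ip (f x) y = ip x (g y)"
  shows "ip ((f ^^ n) x) y = ip x ((g ^^ n) y)"
  by (induction n arbitrary: y) (simp_all add: assms funpow_swap1[of g])

context localisation
begin

lemma friedrichs_angle_eq_norm:
  assumes M: "compl M" and N: "compl N"
  shows "friedrichs_angle \<tau> M N
    = norm ((hs.Proj (loc M) o\<^sub>L hs.Proj (loc N)) - hs.Proj (loc M \<inter> loc N))"
proof -
  have c: "hs.compl (loc M)" "hs.compl (loc N)"
    by (intro loc_compl M N)+
  then have "hs.compl (loc M \<inter> loc N)"
    using hs.submodule_Int[OF c] by (intro closed_submodule_complemented) auto
  with c show ?thesis
    unfolding friedrichs_angle_def
    by (intro norm_blinfun_eq_onorm[symmetric]) (simp add: fun_eq_iff blinfun.diff_left hs.Proj_apply)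
qed

text \<open>On the localisation \<open>Y = D\<^sup>2 - \<delta> D\<close> with \<open>D = 1 - Q P Q\<close> is positive. For \<open>n = \<bar>Y\<bar> - Y\<close>
  one has \<open>Y n = - \<bar>Y\<bar> n\<close>, so this positivity kills all \<open>\<tau> (K (n x)) h\<close> with \<open>K\<^sup>2 = \<bar>Y\<bar>\<close>, and
  injectivity of \<open>\<pi>\<close> gives \<open>K n = 0\<close>, hence \<open>n = 0\<close> and \<open>Y = K\<^sup>2\<close>.\<close>

lemma angle_less_imp_direct_sum:
  assumes M: "compl M" and N: "compl N" and angle: "friedrichs_angle \<tau> M N < 1"
  shows "direct_sum (M \<inter> N) (perp M + perp N)"
proof -
  have cM: "hs.compl (loc M)" and cN: "hs.compl (loc N)"
    by (intro loc_compl M N)+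
  define c where "c = norm ((hs.Proj (loc M) o\<^sub>L hs.Proj (loc N)) - hs.Proj (loc M \<inter> loc N))"
  have c: "c < 1" using angle by (simp add: c_def friedrichs_angle_eq_norm M N)
  define \<delta> where "\<delta> = 1 - c\<^sup>2"
  have "0 \<le> c" by (simp add: c_def)
  then have \<delta>: "\<delta> > 0" using c by (simp add: \<delta>_def abs_square_less_1)
  define D where "D = id_blinfun - (Proj N o\<^sub>L Proj M o\<^sub>L Proj N)"
  define D\<pi> where "D\<pi> = id_blinfun - (hs.Proj (loc N) o\<^sub>L hs.Proj (loc M) o\<^sub>L hs.Proj (loc N))"
  have D\<pi>: "D\<pi> (\<tau> x h) = \<tau> (D x) h" for x h
    by (simp add: D_def D\<pi>_def blinfun.diff_left Proj_loc_\<tau> M N \<tau>_diff)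
  have gap: "\<delta> * Re (cinner z (D\<pi> z)) \<le> (norm (D\<pi> z))\<^sup>2" for z
    using projection_angle_gap[OF cM cN] c unfolding \<delta>_def c_def D\<pi>_def by blast
  have D: "selfadjoint D"
    unfolding D_def by (intro selfadjoint_intros Proj_selfadjoint M N)
  have Dx: "ip (D x) y = ip x (D y)" for x y by (rule selfadjointD[OF D])
  have "norm (Proj N o\<^sub>L Proj M o\<^sub>L Proj N) \<le> norm (Proj N) * norm (Proj M) * norm (Proj N)"
    by (rule norm_blinfun_compose3)
  also have "\<dots> \<le> 1 * 1 * 1"
    by (intro mult_mono norm_projection_le Proj_projection M N) auto
  finally have nD: "norm (id_blinfun - D) \<le> 1" by (simp add: D_def)
  define Y where "Y = (D o\<^sub>L D) - \<delta> *\<^sub>R D"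
  have Y: "selfadjoint Y" unfolding Y_def by (intro selfadjoint_intros commutes_intros D)
  obtain G K where G: "selfadjoint G" "\<And>x. G (G x) = Y (Y x)"
    and K: "selfadjoint K" "\<And>x. K (K x) = G x" "\<And>B. commutes B Y \<Longrightarrow> commutes B K"
    and GY: "commutes Y G"
    using absolute_value_root[OF Y] commutes_intros(3) by metis
  define n where "n = G - Y"
  have n: "selfadjoint n" unfolding n_def by (intro selfadjoint_intros G Y)
  have Yn: "Y (n x) = - G (n x)" for x
    by (simp add: n_def blinfun.bilinear_simps G(2) commutesD[OF GY])
  have Kn: "K (n x) = 0" for x
  proof (rule \<tau>_injective)
    fix h
    define v where "v = \<tau> (n x) h"
    have "cinner v (\<tau> (G (n x)) h) = cinner (\<tau> (K (n x)) h) (\<tau> (K (n x)) h)"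
      by (simp add: v_def cinner_\<tau> selfadjointD[OF K(1)] K(2))
    then have 1: "Re (cinner v (\<tau> (G (n x)) h)) = (norm (\<tau> (K (n x)) h))\<^sup>2"
      by (simp only: Re_cinner_self)
    have "\<tau> (Y (n x)) h = \<tau> (D (D (n x))) h - \<delta> *\<^sub>R \<tau> (D (n x)) h"
      by (simp add: Y_def blinfun.bilinear_simps \<tau>_diff \<tau>_scaleR)
    then have "cinner v (\<tau> (Y (n x)) h) = cinner (D\<pi> v) (D\<pi> v) - \<delta> *\<^sub>R cinner v (D\<pi> v)"
      by (simp add: v_def D\<pi> cinner_\<tau> Dx hs.ip.diff_right hs.ip_scaleR_right)
    then have "Re (cinner v (\<tau> (Y (n x)) h)) = (norm (D\<pi> v))\<^sup>2 - \<delta> * Re (cinner v (D\<pi> v))"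
      by (simp add: cinner_self)
    then have "Re (cinner v (\<tau> (Y (n x)) h)) \<ge> 0" using gap[of v] by simp
    moreover have "\<tau> (Y (n x)) h = - \<tau> (G (n x)) h"
      using \<tau>_scaleR[of "- 1" "G (n x)" h] by (simp add: Yn)
    ultimately have "(norm (\<tau> (K (n x)) h))\<^sup>2 \<le> 0" using 1 by (simp add: hs.ip.minus_right)
    then show "\<tau> (K (n x)) h = 0" by simp
  qed
  have Gn: "G (n x) = 0" for x using K(2)[of "n x"] by (simp add: Kn blinfun.zero_right)
  have nG: "n z = G z - Y z" for z by (simp add: n_def blinfun.diff_left)
  \<comment> \<open>Here n n = G n - Y n = 2 G n = 0; self-adjointness then removes one
    factor.\<close>
  have nn: "n (n x) = 0" for x using nG[of "n x"] Yn[of x] Gn[of x] by simp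
  have "n x = 0" for x
  proof -
    have "ip (n x) (n x) = ip x (n (n x))" by (rule selfadjointD[OF n])
    then show ?thesis by (simp add: nn ip.zero_right)
  qed
  then have GY': "G x = Y x" for x by (simp add: n_def blinfun.diff_left)
  have "\<delta> * norm (D x) \<le> norm (D (D x))" for x
  proof (rule selfadjoint_gap[OF D nD \<delta> K(1)])
    show "D (D x) = \<delta> *\<^sub>R D x + K (K x)" for x
      by (simp add: K(2) GY') (simp add: Y_def blinfun.bilinear_simps)
    show "commutes B K" if "commutes B D" for B
      using that unfolding Y_def by (intro K(3)[unfolded Y_def] commutes_intros)
  qed
  then have "\<exists>v. D (x - D v) = 0" for x
    using selfadjoint_range_complement[OF D \<delta>] by blast
  then show ?thesis by (rule range_complement_imp_direct_sum[OF M N D_def])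
qed

lemma onorm_Cauchy_loc:
  assumes M: "compl M" and N: "compl N" and cauchy: "onorm_Cauchy (\<lambda>n. (Proj M \<circ> Proj N) ^^ n)"
  shows "onorm_Cauchy (\<lambda>n. (hs.Proj (loc M) \<circ> hs.Proj (loc N)) ^^ n)"
  unfolding onorm_Cauchy_def
proof (intro allI impI)
  fix e :: real assume e: "e > 0"
  let ?F = "\<lambda>n. (Proj M \<circ> Proj N) ^^ n" and ?F' = "\<lambda>n. (Proj N \<circ> Proj M) ^^ n"
    and ?G = "\<lambda>n. (hs.Proj (loc M) \<circ> hs.Proj (loc N)) ^^ n"
  \<comment> \<open>A quarter, because lifting costs a factor 2 and the final inequality is
    strict.\<close>
  obtain k where k: "\<And>m n. m \<ge> k \<Longrightarrow> n \<ge> k \<Longrightarrow> onorm (\<lambda>x. ?F m x - ?F n x) < e / 4"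
    using cauchy[unfolded onorm_Cauchy_def, rule_format, of "e / 4"] e by auto
  have bl: "bounded_linear (?F n)" "bounded_linear (?F' n)" "bounded_linear (?G n)" for n
    by (intro bounded_linear_funpow hs.bounded_linear_funpow,
        simp add: comp_def bounded_linear_compose[OF blinfun.bounded_linear_right blinfun.bounded_linear_right])+
  have adj: "ip (?F n x) y = ip x (?F' n y)" for n x y
    by (rule ip_funpow) (simp add: selfadjointD[OF Proj_selfadjoint] M N)
  have lift: "?G n (\<tau> x h) = \<tau> (?F n x) h" for n x h
    by (induction n) (simp_all add: Proj_loc_\<tau> M N)
  show "\<exists>k. \<forall>m\<ge>k. \<forall>n\<ge>k. onorm (\<lambda>x. ?G m x - ?G n x) < e"
  proof (intro exI allI impI)
    fix m n assume mn: "m \<ge> k" "n \<ge> k"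
    define T where "T = Blinfun (?F m) - Blinfun (?F n)"
    define T' where "T' = Blinfun (?F' m) - Blinfun (?F' n)"
    define S where "S = Blinfun (?G m) - Blinfun (?G n)"
    have T: "blinfun_apply T = (\<lambda>x. ?F m x - ?F n x)"
      and T': "blinfun_apply T' = (\<lambda>x. ?F' m x - ?F' n x)"
      and S: "blinfun_apply S = (\<lambda>x. ?G m x - ?G n x)"
      by (simp_all add: T_def T'_def S_def fun_eq_iff blinfun.diff_left bounded_linear_Blinfun_apply bl)
    have "norm S \<le> 2 * (e / 4)"
    proof (rule norm_lift_le)
      show "adjoint_pair T T'" by (simp add: adjoint_pair_def T T' adj ip.diff_left ip.diff_right)
      show "lifts T S" by (simp add: lifts_def T S lift \<tau>_diff)
      show "norm T \<le> e / 4" using k[OF mn] norm_blinfun_eq_onorm[OF T] by simp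
    qed (use e in simp)
    then show "onorm (\<lambda>x. ?G m x - ?G n x) < e" using e norm_blinfun_eq_onorm[OF S] by simp
  qed
qed

text \<open>The module results are applied to the Hilbert space \<open>'k\<close>. There, Cauchy
  powers give the norm bound with the projection onto the intersection of the localised submodules,
  exactly as in the angle.\<close>

lemma onorm_Cauchy_imp_angle_less:
  assumes M: "compl M" and N: "compl N" and cauchy: "onorm_Cauchy (\<lambda>n. (Proj M \<circ> Proj N) ^^ n)"
  shows "friedrichs_angle \<tau> M N < 1"
proof -
  have c: "hs.compl (loc M)" "hs.compl (loc N)"
    by (intro loc_compl M N)+
  show ?thesis
    unfolding friedrichs_angle_eq_norm[OF M N]
    by (intro hs.direct_sum_imp_norm_less hs.onorm_Cauchy_imp_direct_sum onorm_Cauchy_loc c M N cauchy)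
qed

end

section \<open>The equivalences\<close>

lemma tfaeI: "(\<And>p. p \<in> set ps \<Longrightarrow> p \<longleftrightarrow> q) \<Longrightarrow> tfae ps"
  by (auto simp: tfae_def)

context hilbert_module
begin

lemma onorm_Cauchy_iff_direct_sum:
  assumes "compl M" "compl N"
  shows "onorm_Cauchy (\<lambda>n. (Proj M \<circ> Proj N) ^^ n) \<longleftrightarrow> direct_sum (M \<inter> N) (perp M + perp N)"
  using onorm_Cauchy_imp_direct_sum[OF assms] direct_sum_imp_norm_less[OF assms]
    direct_sum_imp_perp_Int(2)[OF assms] norm_less_imp_onorm_Cauchy[OF assms] by blast

lemma onorm_less_iff_direct_sum:
  assumes M: "compl M" and N: "compl N"
  shows "compl (M \<inter> N) \<and>
      onorm (\<lambda>x. Proj M (Proj N x) - proj ip (M \<inter> N) x) = onorm (\<lambda>x. Proj N (Proj M x) - proj ip (M \<inter> N) x) \<and>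
      onorm (\<lambda>x. Proj M (Proj N x) - proj ip (M \<inter> N) x) < 1
    \<longleftrightarrow> direct_sum (M \<inter> N) (perp M + perp N)" (is "?C \<and> ?E \<and> ?L \<longleftrightarrow> ?D")
proof -
  \<comment> \<open>The description \<open>proj ip (M \<inter> N)\<close> is known to be the
    projection only for a complemented intersection, so the operator norms are identified under
    \<open>?C\<close>.\<close>
  have "onorm (\<lambda>x. Proj M (Proj N x) - proj ip (M \<inter> N) x) = norm ((Proj M o\<^sub>L Proj N) - Proj (M \<inter> N))"
    "onorm (\<lambda>x. Proj N (Proj M x) - proj ip (M \<inter> N) x) = norm ((Proj N o\<^sub>L Proj M) - Proj (M \<inter> N))" if ?C
    by (rule norm_blinfun_eq_onorm[symmetric], simp add: fun_eq_iff blinfun.diff_left Proj_apply that)+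
  then have "?C \<and> ?E \<and> ?L \<longleftrightarrow> ?C \<and> norm ((Proj M o\<^sub>L Proj N) - Proj (M \<inter> N)) < 1"
    using norm_Proj_Proj_diff_commute[OF assms] by auto
  also have "\<dots> \<longleftrightarrow> ?D"
    using direct_sum_imp_norm_less[OF assms] direct_sum_imp_perp_Int(2)[OF assms]
      norm_less_imp_onorm_Cauchy[OF assms] onorm_Cauchy_imp_direct_sum[OF assms] by blast
  finally show ?thesis .
qed

lemma direct_sum_imp_bij_betw:
  assumes M: "compl M" and N: "compl N" and ds: "direct_sum (M \<inter> N) (perp M + perp N)"
  shows "bij_betw (\<lambda>x. x - Proj M (Proj N x)) (perp (M \<inter> N)) (perp (M \<inter> N))"
  using norm_less_imp_bij_betw[OF M N] direct_sum_imp_perp_Int(2)[OF assms]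
    direct_sum_imp_norm_less[OF assms] by blast

lemma direct_sum_commute:
  "direct_sum (M \<inter> N) (perp M + perp N) \<longleftrightarrow> direct_sum (N \<inter> M) (perp N + perp M)"
  by (simp add: Int_commute add.commute)

lemma bij_betw_iff_direct_sum:
  assumes M: "compl M" and N: "compl N"
  shows "compl (M \<inter> N) \<and> bij_betw (\<lambda>x. x - Proj M (Proj N x)) (perp (M \<inter> N)) (perp (M \<inter> N)) \<and>
      bij_betw (\<lambda>x. x - Proj N (Proj M x)) (perp (M \<inter> N)) (perp (M \<inter> N))
    \<longleftrightarrow> direct_sum (M \<inter> N) (perp M + perp N)"
  using direct_sum_imp_bij_betw[OF M N] direct_sum_imp_bij_betw[OF N M] direct_sum_commute[of M N]
    direct_sum_imp_perp_Int(2)[OF M N] bij_betw_imp_closed_range[OF M N] closed_range_imp_direct_sum[OF M N]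
  by (auto simp: Int_commute)

lemma closed_range_iff_direct_sum:
  assumes M: "compl M" and N: "compl N"
  shows "closed (range (\<lambda>x. x - Proj M (Proj N x))) \<and> closed (range (\<lambda>x. x - Proj N (Proj M x)))
    \<longleftrightarrow> direct_sum (M \<inter> N) (perp M + perp N)"
  using bij_betw_iff_direct_sum[OF M N] bij_betw_iff_direct_sum[OF N M] direct_sum_commute[of M N]
    bij_betw_imp_closed_range[OF M N] bij_betw_imp_closed_range[OF N M] closed_range_imp_direct_sum[OF M N]
  by blast

end

theorem proposition3p12:
  fixes act :: "'x::complex_banach \<Rightarrow> 'b::cstar_algebra \<Rightarrow> 'x"
    and ip :: "'x \<Rightarrow> 'x \<Rightarrow> 'b"
    and M N :: "'x set"
  assumes "hilbert_module act ip"
    and "complemented act ip M"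
    and "complemented act ip N"
  shows "let P = proj ip M; Q = proj ip N; R = proj ip (M \<inter> N);
             M' = orth ip M; N' = orth ip N; L = orth ip (M \<inter> N);
             cond2 = onorm_Cauchy (\<lambda>n. (P \<circ> Q) ^^ n)
         in
         (\<forall>(\<pi> :: 'b \<Rightarrow> 'h::complex_hilbert_space \<Rightarrow> 'h) (\<tau> :: 'x \<Rightarrow> 'h \<Rightarrow> 'k::complex_hilbert_space).
            faithful_representation \<pi> \<and> interior_tensor_product act ip \<pi> \<tau> \<longrightarrow>
              (friedrichs_angle \<tau> M N < 1 \<longleftrightarrow> cond2)) \<and>
         tfae
          [cond2,
           complemented act ip (M \<inter> N) \<and>
             onorm (\<lambda>x. P (Q x) - R x) = onorm (\<lambda>x. Q (P x) - R x) \<and>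
             onorm (\<lambda>x. P (Q x) - R x) < 1,
           complemented act ip (M \<inter> N) \<and>
             bij_betw (\<lambda>x. x - P (Q x)) L L \<and> bij_betw (\<lambda>x. x - Q (P x)) L L,
           closed (range (\<lambda>x. x - P (Q x))) \<and> closed (range (\<lambda>x. x - Q (P x))),
           direct_sum (M \<inter> N) (M' + N'),
           closed (M' + N'),
           direct_sum (M' \<inter> N') (M + N),
           closed (M + N),
           complemented act ip (M \<inter> N) \<and> closed ((L \<inter> M) + (L \<inter> N))]"
proof -
  interpret hilbert_module act ip by fact
  note M = assms(2) and N = assms(3)
  have P: "proj ip M = blinfun_apply (Proj M)" and Q: "proj ip N = blinfun_apply (Proj N)"
    by (simp_all add: Proj_apply M N)
  let ?D = "direct_sum (M \<inter> N) (perp M + perp N)"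
  have angle: "friedrichs_angle \<tau> M N < 1 \<longleftrightarrow> onorm_Cauchy (\<lambda>n. (proj ip M \<circ> proj ip N) ^^ n)"
    if "faithful_representation \<pi> \<and> interior_tensor_product act ip \<pi> \<tau>"
    for \<pi> :: "'b \<Rightarrow> 'h \<Rightarrow> 'h" and \<tau> :: "'x \<Rightarrow> 'h \<Rightarrow> 'k"
  proof -
    interpret localisation act ip \<pi> \<tau> by unfold_locales (use that in auto)
    show ?thesis
      using angle_less_imp_direct_sum[OF M N] onorm_Cauchy_imp_angle_less[OF M N]
        onorm_Cauchy_iff_direct_sum[OF M N] unfolding P Q by blast
  qed
  note 7 = direct_sum_iff_closed[OF M N, symmetric]
  have 9: "closed (M + N) \<longleftrightarrow> ?D"
    using 7 closed_perp_sum_iff_closed_sum[OF M N] by simp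
  \<comment> \<open>The criterion is applied to the complements of \<open>M\<close> and
    \<open>N\<close>, whose own complements are \<open>M\<close> and \<open>N\<close> again.\<close>
  have 8: "direct_sum (perp M \<inter> perp N) (M + N) \<longleftrightarrow> ?D"
    using direct_sum_iff_closed[OF compl_perp(1)[OF M] compl_perp(1)[OF N]] 9
    by (simp only: perp_perp M N)
  have 10: "compl (M \<inter> N) \<and> closed ((perp (M \<inter> N) \<inter> M) + (perp (M \<inter> N) \<inter> N)) \<longleftrightarrow> ?D"
    using closed_sum_iff_closed_reduced_sum[OF M N] direct_sum_imp_perp_Int(2)[OF M N] 9 by blast
  show ?thesis
    unfolding Let_def
  proof (intro conjI allI impI)
    show "tfae
      [onorm_Cauchy (\<lambda>n. (proj ip M \<circ> proj ip N) ^^ n),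
       compl (M \<inter> N) \<and>
         onorm (\<lambda>x. proj ip M (proj ip N x) - proj ip (M \<inter> N) x) =
         onorm (\<lambda>x. proj ip N (proj ip M x) - proj ip (M \<inter> N) x) \<and>
         onorm (\<lambda>x. proj ip M (proj ip N x) - proj ip (M \<inter> N) x) < 1,
       compl (M \<inter> N) \<and>
         bij_betw (\<lambda>x. x - proj ip M (proj ip N x)) (perp (M \<inter> N)) (perp (M \<inter> N)) \<and>
         bij_betw (\<lambda>x. x - proj ip N (proj ip M x)) (perp (M \<inter> N)) (perp (M \<inter> N)),
       closed (range (\<lambda>x. x - proj ip M (proj ip N x))) \<and>
         closed (range (\<lambda>x. x - proj ip N (proj ip M x))),
       ?D, closed (perp M + perp N), direct_sum (perp M \<inter> perp N) (M + N), closed (M + N),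
       compl (M \<inter> N) \<and> closed ((perp (M \<inter> N) \<inter> M) + (perp (M \<inter> N) \<inter> N))]"
      unfolding P Q onorm_Cauchy_iff_direct_sum[OF M N] onorm_less_iff_direct_sum[OF M N]
        bij_betw_iff_direct_sum[OF M N] closed_range_iff_direct_sum[OF M N] 7 8 9 10
      by (rule tfaeI[where q = ?D]) auto
  qed (rule angle)
qed

end
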